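(* Let $z_0\in\mathbb{C}$, let $f$ be a complex-valued function holomorphic on an open neighbourhood of $z_0$ with $f(z_0)=z_0$, and suppose that $\lambda:=f'(z_0)$ satisfies $0<|\lambda|<1$. Let $U$ be an open neighbourhood of $z_0$ (contained in the domain of $f$) with $f(U)\subset U$, let $V$ be an open neighbourhood of $0$ with $\lambda V\subset V$, and let $\varphi:U\to V$ be a conformal map such that $\varphi\circ f^n=\lambda^n\cdot\varphi$ holds on $U$ for all $n\in\mathbb{N}$. Then the set of all functions in $H(\mathbb{C}\setminus\{z_0\})$ which are $H(W)$-universal for $C_f$ for all $W\in\mathcal{U}_0(U\setminus\{z_0\})$ is a comeager set in $H(\mathbb{C}\setminus\{z_0\})$.
   Context: $\mathbb{N}=\{1,2,\dots\}$; $f^n$ is the $n$-th iterate of $f$. A conformal map is a bijective holomorphic map. (Sets $U$, $V$ and a map $\varphi$ as in the claim exist by Koenigs' linearization theorem.) For an open set $W\subset\mathbb{C}$, $H(W)$ is the Fréchet space of complex-valued holomorphic functions on $W$ with the topology of locally uniform convergence. A hole of a set $M\subset\mathbb{C}$ is a component $H$ of $\mathbb{C}_\infty\setminus M$ with $\infty\notin H$, where $\mathbb{C}_\infty=\mathbb{C}\cup\{\infty\}$. $\mathcal{U}_0(M)$ is the set of all non-empty subsets of $M$ which are open in $\mathbb{C}$ and have no holes. For an open set $W\subset U\setminus\{z_0\}$, a function $g\in H(\mathbb{C}\setminus\{z_0\})$ is called $H(W)$-universal for $C_f$ (the composition operator $g\mapsto g\circ f$) if $\{g\circ f^n|_W:n\in\mathbb{N}\}$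 is dense in $H(W)$. A subset of a Baire space is comeager if it contains a dense $G_\delta$-set. *)

theory Defs
  imports "HOL-Analysis.Analysis"
begin

(* A holomorphic function on W is represented by its unique extension to the whole plane
   that is undefined off W, so that equality of functions on W is equality in HOL. *)
definition hol_space :: "complex set \<Rightarrow> (complex \<Rightarrow> complex) set" where
  "hol_space W = {g \<in> extensional W. g holomorphic_on W}"

(* Since the plane is locally compact, locally uniform convergence on an open set is uniform
   convergence on its compact subsets; see limitin_hol_topology below. *)
definition hol_topology :: "complex set \<Rightarrow> (complex \<Rightarrow> complex) topology" where
  "hol_topology W = topology (\<lambda>A. A \<subseteq> hol_space W \<and>
     (\<forall>g\<in>A. \<exists>K e. compact K \<and> K \<subseteq> W \<and> e > 0 \<and>
        {h \<in> hol_space W. \<forall>z\<in>K. dist (h z) (g z) < e} \<subseteq> A))"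

lemma openin_hol_topology:
  "openin (hol_topology W) A \<longleftrightarrow> A \<subseteq> hol_space W \<and>
     (\<forall>g\<in>A. \<exists>K e. compact K \<and> K \<subseteq> W \<and> e > 0 \<and>
        {h \<in> hol_space W. \<forall>z\<in>K. dist (h z) (g z) < e} \<subseteq> A)"
proof -
  define N where "N K e g = {h \<in> hol_space W. \<forall>z\<in>K. dist (h z) (g z) < e}"
    for K and e :: real and g
  define P where "P A \<longleftrightarrow> A \<subseteq> hol_space W \<and>
     (\<forall>g\<in>A. \<exists>K e. compact K \<and> K \<subseteq> W \<and> e > 0 \<and> N K e g \<subseteq> A)" for A
  have PI: "P A" if "A \<subseteq> hol_space W"
    "\<And>g. g \<in> A \<Longrightarrow> \<exists>K e. compact K \<and> K \<subseteq> W \<and> e > 0 \<and> N K e g \<subseteq> A" for A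
    using that unfolding P_def by simp
  have PD: "A \<subseteq> hol_space W" if "P A" for A
    using that unfolding P_def by simp
  have PE: "\<exists>K e. compact K \<and> K \<subseteq> W \<and> e > 0 \<and> N K e g \<subseteq> A" if "P A" "g \<in> A" for A g
    using that unfolding P_def by simp
  have int: "P (A \<inter> B)" if A: "P A" and B: "P B" for A B
  proof (rule PI)
    show "A \<inter> B \<subseteq> hol_space W" using PD[OF A] by blast
  next
    fix g assume g: "g \<in> A \<inter> B"
    obtain K d where K: "compact K" "K \<subseteq> W" "d > 0" "N K d g \<subseteq> A"
      using PE[OF A] g by blast
    obtain L e where L: "compact L" "L \<subseteq> W" "e > 0" "N L e g \<subseteq> B"
      using PE[OF B] g by blast
    have "N (K \<union> L) (min d e) g \<subseteq> N K d g \<inter> N L e g"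
      unfolding N_def by auto
    then have "N (K \<union> L) (min d e) g \<subseteq> A \<inter> B"
      using K(4) L(4) by blast
    moreover have "compact (K \<union> L)" "K \<union> L \<subseteq> W" "min d e > 0"
      using K L by auto
    ultimately show "\<exists>K e. compact K \<and> K \<subseteq> W \<and> e > 0 \<and> N K e g \<subseteq> A \<inter> B"
      by blast
  qed
  have union: "P (\<Union>\<A>)" if \<A>: "\<forall>A\<in>\<A>. P A" for \<A>
  proof (rule PI)
    show "\<Union>\<A> \<subseteq> hol_space W" using \<A> PD by (meson Sup_least)
  next
    fix g assume "g \<in> \<Union>\<A>"
    then obtain A where A: "A \<in> \<A>" "g \<in> A" by blast
    then obtain K e where "compact K" "K \<subseteq> W" "e > 0" "N K e g \<subseteq> A"
      using PE[of A g] \<A> by blast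
    moreover from this have "N K e g \<subseteq> \<Union>\<A>"
      using A(1) by blast
    ultimately show "\<exists>K e. compact K \<and> K \<subseteq> W \<and> e > 0 \<and> N K e g \<subseteq> \<Union>\<A>"
      by blast
  qed
  have "istopology P"
    unfolding istopology_def using int union by blast
  then have "openin (topology P) A \<longleftrightarrow> P A"
    by (simp add: topology_inverse')
  moreover have "hol_topology W = topology P"
    unfolding hol_topology_def P_def[abs_def] N_def by (rule refl)
  ultimately show ?thesis
    unfolding P_def N_def by simp
qed

lemma topspace_hol_topology [simp]: "topspace (hol_topology W) = hol_space W"
proof
  show "topspace (hol_topology W) \<subseteq> hol_space W"
    using openin_topspace[of "hol_topology W"] unfolding openin_hol_topology by blast
  have "openin (hol_topology W) (hol_space W)"
    unfolding openin_hol_topology by (intro conjI ballI exI[of _ "{}"] exI[of _ 1]) auto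
  then show "hol_space W \<subseteq> topspace (hol_topology W)"
    by (rule openin_subset)
qed

lemma openin_hol_nbhd:
  assumes K: "compact K" "K \<subseteq> W" and g: "g \<in> hol_space W"
  shows "openin (hol_topology W) {h \<in> hol_space W. \<forall>z\<in>K. dist (h z) (g z) < e}"
  unfolding openin_hol_topology
proof (intro conjI ballI)
  fix h assume "h \<in> {h \<in> hol_space W. \<forall>z\<in>K. dist (h z) (g z) < e}"
  then have h: "h \<in> hol_space W" and lt: "\<And>z. z \<in> K \<Longrightarrow> dist (h z) (g z) < e" by auto
  have cont: "continuous_on K (\<lambda>z. dist (h z) (g z))"
    using g h K(2) unfolding hol_space_def
    by (intro continuous_on_dist) (auto intro: holomorphic_on_imp_continuous_on continuous_on_subset)
  obtain d where d: "d > 0" "\<And>z. z \<in> K \<Longrightarrow> dist (h z) (g z) + d \<le> e"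
  proof (cases "K = {}")
    case True
    then show ?thesis using that[of 1] by simp
  next
    case False
    then obtain x where x: "x \<in> K" "\<And>z. z \<in> K \<Longrightarrow> dist (h z) (g z) \<le> dist (h x) (g x)"
      using continuous_attains_sup[OF K(1) _ cont] by blast
    show ?thesis
      using that[of "e - dist (h x) (g x)"] x lt by fastforce
  qed
  have "{k \<in> hol_space W. \<forall>z\<in>K. dist (k z) (h z) < d}
        \<subseteq> {h \<in> hol_space W. \<forall>z\<in>K. dist (h z) (g z) < e}"
  proof clarify
    fix k z assume "\<forall>z\<in>K. dist (k z) (h z) < d" and z: "z \<in> K"
    then have "dist (k z) (h z) < d" by blast
    then show "dist (k z) (g z) < e"
      using d(2)[OF z] dist_triangle[of "k z" "g z" "h z"] by linarith
  qed
  then show "\<exists>K' d. compact K' \<and> K' \<subseteq> W \<and> d > 0 \<and> {k \<in> hol_space W. \<forall>z\<in>K'. dist (k z) (h z) < d}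
        \<subseteq> {h \<in> hol_space W. \<forall>z\<in>K. dist (h z) (g z) < e}"
    using K d(1) by blast
qed auto

lemma limitin_hol_topology:
  assumes "\<And>x. G x \<in> hol_space W" "g \<in> hol_space W"
  shows "limitin (hol_topology W) G g F \<longleftrightarrow>
           (\<forall>K. compact K \<and> K \<subseteq> W \<longrightarrow> uniform_limit K G g F)"
proof
  assume L: "limitin (hol_topology W) G g F"
  show "\<forall>K. compact K \<and> K \<subseteq> W \<longrightarrow> uniform_limit K G g F"
  proof (intro allI impI)
    fix K assume K: "compact K \<and> K \<subseteq> W"
    show "uniform_limit K G g F"
      unfolding uniform_limit_iff
    proof (intro allI impI)
      fix e :: real assume "e > 0"
      then have "\<forall>\<^sub>F x in F. G x \<in> {h \<in> hol_space W. \<forall>z\<in>K. dist (h z) (g z) < e}"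
        using L openin_hol_nbhd[of K W g e] K assms(2) unfolding limitin_def by auto
      then show "\<forall>\<^sub>F x in F. \<forall>z\<in>K. dist (G x z) (g z) < e"
        by (rule eventually_mono) auto
    qed
  qed
next
  assume R: "\<forall>K. compact K \<and> K \<subseteq> W \<longrightarrow> uniform_limit K G g F"
  show "limitin (hol_topology W) G g F"
    unfolding limitin_def
  proof (intro conjI allI impI)
    fix A assume A: "openin (hol_topology W) A \<and> g \<in> A"
    then obtain K e where K: "compact K" "K \<subseteq> W" "e > 0"
        "{h \<in> hol_space W. \<forall>z\<in>K. dist (h z) (g z) < e} \<subseteq> A"
      unfolding openin_hol_topology by blast
    have "\<forall>\<^sub>F x in F. \<forall>z\<in>K. dist (G x z) (g z) < e"
      using R K unfolding uniform_limit_iff by blast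
    then show "\<forall>\<^sub>F x in F. G x \<in> A"
      by (rule eventually_mono) (use K(4) assms(1) in blast)
  qed (use assms in simp)
qed

definition dense_in :: "'a topology \<Rightarrow> 'a set \<Rightarrow> bool" where
  "dense_in X S \<longleftrightarrow> S \<subseteq> topspace X \<and> X closure_of S = topspace X"

definition comeager_in :: "'a topology \<Rightarrow> 'a set \<Rightarrow> bool" where
  "comeager_in X S \<longleftrightarrow> S \<subseteq> topspace X \<and> (\<exists>G. gdelta_in X G \<and> dense_in X G \<and> G \<subseteq> S)"

definition conformal_map :: "(complex \<Rightarrow> complex) \<Rightarrow> complex set \<Rightarrow> complex set \<Rightarrow> bool" where
  "conformal_map \<phi> U V \<longleftrightarrow> \<phi> holomorphic_on U \<and> bij_betw \<phi> U V"

(* The Riemann sphere is the one-point compactification of the plane, with None as infinity. *)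
definition riemann_sphere :: "complex option topology" where
  "riemann_sphere = Alexandroff_compactification euclidean"

definition holes :: "complex set \<Rightarrow> complex option set set" where
  "holes M = {H \<in> connected_components_of (subtopology riemann_sphere (UNIV - Some ` M)). None \<notin> H}"

definition open_without_holes :: "complex set \<Rightarrow> complex set set" where
  "open_without_holes M = {W. W \<noteq> {} \<and> W \<subseteq> M \<and> open W \<and> holes W = {}}"

definition universal_for :: "complex \<Rightarrow> (complex \<Rightarrow> complex) \<Rightarrow> complex set \<Rightarrow> (complex \<Rightarrow> complex) \<Rightarrow> bool" where
  "universal_for z\<^sub>0 f W g \<longleftrightarrow> g \<in> hol_space (UNIV - {z\<^sub>0}) \<and>
     dense_in (hol_topology W) {restrict (g \<circ> (f ^^ n)) W | n::nat. n \<ge> 1}"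

end

theory Submission
  imports Defs "HOL-Complex_Analysis.Complex_Analysis"
begin

text \<open>
  The maps \<open>f ^^ n\<close> are injective on \<open>U\<close>, fix \<open>z\<^sub>0\<close>, and contract compact sets to \<open>z\<^sub>0\<close>, because
  in the coordinate \<open>\<phi>\<close> they are multiplication by \<open>lam ^ n\<close>. A function \<open>g\<close> that is holomorphic away
  from \<open>z\<^sub>0\<close> is therefore almost unconstrained on \<open>(f ^^ n) ` K\<close> by its behaviour on a fixed compact set \<open>L\<close>
  that avoids \<open>z\<^sub>0\<close>: once \<open>(f ^^ n) ` K\<close> lies in a small disc around \<open>z\<^sub>0\<close>, Runge's theorem provides a
  correction, a polynomial in \<open>1 / (z - z\<^sub>0)\<close>, that is small on \<open>L\<close> and makes \<open>g \<circ> f ^^ n\<close> approximate a given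
  function on \<open>K\<close>. So the set \<open>hits K p e\<close> of all \<open>g\<close> for which some \<open>g \<circ> f ^^ n\<close> approximates a given
  \<open>p\<close> on \<open>K\<close> is open (\<open>openin_hits\<close>) and dense (\<open>dense_in_hits\<close>).

  Countably many of these sets suffice for all \<open>W\<close> simultaneously. The compact sets \<open>K\<close> may be taken from a
  countable family that does not depend on \<open>W\<close>, and the functions to approximate may be taken to be
  polynomials in \<open>1 / (z - z\<^sub>0)\<close> with coefficients from a countable dense set; that these are dense in
  \<open>H(W)\<close> is again Runge's theorem. Baire's theorem for \<open>H(W)\<close> (\<open>hol_space_Baire\<close>) then finishes the proof.

  Runge's theorem is needed here on images of compact subsets of \<open>W\<close> under the maps \<open>f ^^ n\<close>. Its
  topological hypothesis is handled as follows. The components of an open set without holes are simply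
  connected (\<open>no_holes_component_simply_connected\<close>), hence images of the unit disc under Riemann maps, and
  a compact set lies in the union of finitely many images of smaller closed discs
  (\<open>no_holes_Riemann_discs\<close>). Injective images of this picture have the same form, and the complement
  of finitely many disjoint closed topological discs is connected by Janiszewski's theorem. The Riemann
  maps also supply the contours for Cauchy's formula, so that no grid construction is required
  (\<open>simultaneous_Runge\<close>).
\<close>

section \<open>Uniform approximation by polynomials in \<open>1 / (z - z\<^sub>0)\<close>\<close>

text \<open>
  For \<open>z\<^sub>0\<close> outside the closed set \<open>M\<close> these functions form a uniformly closed algebra of bounded functions
  on \<open>M\<close>. The set \<open>M\<close> is allowed to be unbounded, since \<open>1 / (z - z\<^sub>0)\<close> stays bounded on it.
\<close>
definition pole_approx :: "complex \<Rightarrow> complex set \<Rightarrow> (complex \<Rightarrow> complex) \<Rightarrow> bool" where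
  "pole_approx z\<^sub>0 M F \<longleftrightarrow> (\<forall>e>0. \<exists>p. \<forall>z\<in>M. dist (F z) (poly p (1 / (z - z\<^sub>0))) < e)"

lemma pole_approx_poly: "pole_approx z\<^sub>0 M (\<lambda>z. poly p (1 / (z - z\<^sub>0)))"
  unfolding pole_approx_def by (intro allI impI exI[of _ p]) auto

lemma pole_approx_const: "pole_approx z\<^sub>0 M (\<lambda>z. c)"
  using pole_approx_poly[of z\<^sub>0 M "[:c:]"] by simp

lemma pole_approx_limit:
  assumes "\<And>e. e > 0 \<Longrightarrow> \<exists>G. pole_approx z\<^sub>0 M G \<and> (\<forall>z\<in>M. dist (F z) (G z) \<le> e)"
  shows "pole_approx z\<^sub>0 M F"
  unfolding pole_approx_def
proof (intro allI impI)
  fix e :: real assume "e > 0"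
  then have "e/2 > 0" by simp
  obtain G where G: "pole_approx z\<^sub>0 M G" "\<forall>z\<in>M. dist (F z) (G z) \<le> e/2"
    using assms[OF \<open>e/2 > 0\<close>] by auto
  obtain p where p: "\<forall>z\<in>M. dist (G z) (poly p (1 / (z - z\<^sub>0))) < e/2"
    using G(1) \<open>e/2 > 0\<close> unfolding pole_approx_def by blast
  have "dist (F z) (poly p (1 / (z - z\<^sub>0))) < e" if "z \<in> M" for z
  proof -
    have "dist (F z) (G z) \<le> e/2" "dist (G z) (poly p (1 / (z - z\<^sub>0))) < e/2"
      using G(2) p that by auto
    then show ?thesis
      using dist_triangle[of "F z" "poly p (1 / (z - z\<^sub>0))" "G z"] by linarith
  qed
  then show "\<exists>p. \<forall>z\<in>M. dist (F z) (poly p (1 / (z - z\<^sub>0))) < e" by blast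
qed

lemma pole_approx_add:
  assumes "pole_approx z\<^sub>0 M F" "pole_approx z\<^sub>0 M G"
  shows "pole_approx z\<^sub>0 M (\<lambda>z. F z + G z)"
  unfolding pole_approx_def
proof (intro allI impI)
  fix e :: real assume "e > 0"
  then have e: "e/2 > 0" by simp
  obtain p q where p: "\<forall>z\<in>M. dist (F z) (poly p (1 / (z - z\<^sub>0))) < e/2"
    and q: "\<forall>z\<in>M. dist (G z) (poly q (1 / (z - z\<^sub>0))) < e/2"
    using assms e unfolding pole_approx_def by metis
  have "dist (F z + G z) (poly (p + q) (1 / (z - z\<^sub>0))) < e" if "z \<in> M" for z
  proof -
    have "dist (F z) (poly p (1 / (z - z\<^sub>0))) < e/2" "dist (G z) (poly q (1 / (z - z\<^sub>0))) < e/2"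
      using p q that by auto
    then show ?thesis
      using dist_triangle_add[of "F z" "G z" "poly p (1 / (z - z\<^sub>0))" "poly q (1 / (z - z\<^sub>0))"]
      by (simp only: poly_add)
  qed
  then show "\<exists>p. \<forall>z\<in>M. dist (F z + G z) (poly p (1 / (z - z\<^sub>0))) < e" by blast
qed

lemma pole_approx_sum:
  assumes "\<And>i. i \<in> I \<Longrightarrow> pole_approx z\<^sub>0 M (F i)"
  shows "pole_approx z\<^sub>0 M (\<lambda>z. \<Sum>i\<in>I. F i z)"
  using assms
  by (induction I rule: infinite_finite_induct) (auto intro: pole_approx_const pole_approx_add)

lemma inverse_distance_bounded:
  fixes z\<^sub>0 :: complex
  assumes "closed M" "z\<^sub>0 \<notin> M"
  obtains B where "\<And>z. z \<in> M \<Longrightarrow> norm (1 / (z - z\<^sub>0)) \<le> B"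
proof -
  obtain d where d: "d > 0" "\<forall>z\<in>M. d \<le> dist z\<^sub>0 z"
    using separate_point_closed[OF assms] by auto
  have "norm (1 / (z - z\<^sub>0)) \<le> 1/d" if "z \<in> M" for z
    using d that by (auto simp: norm_divide dist_norm norm_minus_commute intro!: frac_le)
  then show ?thesis by (rule that)
qed

lemma poly_bounded_on_cball:
  fixes p :: "complex poly"
  obtains B where "B > 0" "\<And>w. norm w \<le> R \<Longrightarrow> norm (poly p w) \<le> B"
proof -
  have "compact (poly p ` cball 0 R)"
    by (intro compact_continuous_image continuous_intros) auto
  then obtain B where "B > 0" "\<forall>x \<in> poly p ` cball 0 R. norm x \<le> B"
    using compact_imp_bounded bounded_pos by metis
  then show ?thesis using that[of B] by auto
qed

lemma pole_approx_bounded: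
  assumes "closed M" "z\<^sub>0 \<notin> M" "pole_approx z\<^sub>0 M F"
  obtains B where "B > 0" "\<And>z. z \<in> M \<Longrightarrow> norm (F z) \<le> B"
proof -
  obtain R where R: "\<And>z. z \<in> M \<Longrightarrow> norm (1 / (z - z\<^sub>0)) \<le> R"
    using inverse_distance_bounded[OF assms(1,2)] by blast
  obtain p where p: "\<forall>z\<in>M. dist (F z) (poly p (1 / (z - z\<^sub>0))) < 1"
    using assms(3) unfolding pole_approx_def by (meson zero_less_one)
  obtain B where B: "B > 0" "\<And>w. norm w \<le> R \<Longrightarrow> norm (poly p w) \<le> B"
    using poly_bounded_on_cball[of R p] by blast
  have "norm (F z) \<le> B + 1" if "z \<in> M" for z
  proof -
    have "norm (F z) \<le> norm (poly p (1 / (z - z\<^sub>0))) + dist (F z) (poly p (1 / (z - z\<^sub>0)))"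
      by (metis dist_norm norm_triangle_sub)
    moreover have "dist (F z) (poly p (1 / (z - z\<^sub>0))) < 1" using p that by blast
    ultimately show ?thesis using B(2)[OF R[OF that]] by linarith
  qed
  then show ?thesis using that[of "B + 1"] B(1) by simp
qed

lemma pole_approx_mult:
  assumes M: "closed M" "z\<^sub>0 \<notin> M" and F: "pole_approx z\<^sub>0 M F" and G: "pole_approx z\<^sub>0 M G"
  shows "pole_approx z\<^sub>0 M (\<lambda>z. F z * G z)"
proof (rule pole_approx_limit)
  fix e :: real assume e: "e > 0"
  obtain B where B: "B > 0" "\<And>z. z \<in> M \<Longrightarrow> norm (F z) \<le> B"
    using pole_approx_bounded[OF M F] by blast
  have "e / (2*B) > 0" using B(1) e by simp
  then obtain q where q: "\<forall>z\<in>M. dist (G z) (poly q (1 / (z - z\<^sub>0))) < e / (2*B)"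
    using G unfolding pole_approx_def by blast
  obtain C where C: "C > 0" "\<And>z. z \<in> M \<Longrightarrow> norm (poly q (1 / (z - z\<^sub>0))) \<le> C"
    using pole_approx_bounded[OF M pole_approx_poly[of z\<^sub>0 M q]] by auto
  have "e / (2*C) > 0" using C(1) e by simp
  then obtain p where p: "\<forall>z\<in>M. dist (F z) (poly p (1 / (z - z\<^sub>0))) < e / (2*C)"
    using F unfolding pole_approx_def by blast
  have "dist (F z * G z) (poly (p * q) (1 / (z - z\<^sub>0))) \<le> e" if "z \<in> M" for z
  proof -
    define P Q where "P = poly p (1 / (z - z\<^sub>0))" and "Q = poly q (1 / (z - z\<^sub>0))"
    have "F z * G z - P * Q = F z * (G z - Q) + (F z - P) * Q" by (simp add: algebra_simps)
    then have "norm (F z * G z - P * Q) \<le> norm (F z) * norm (G z - Q) + norm (F z - P) * norm Q"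
      by (metis norm_mult norm_triangle_ineq)
    also have "\<dots> \<le> B * (e / (2*B)) + (e / (2*C)) * C"
    proof (intro add_mono mult_mono)
      show "norm (G z - Q) \<le> e / (2*B)" "norm (F z - P) \<le> e / (2*C)"
        using p q that by (auto simp: P_def Q_def dist_norm less_imp_le)
      show "norm Q \<le> C" using C(2)[OF that] by (simp add: Q_def)
      show "norm (F z) \<le> B" using B(2)[OF that] .
    qed (use B C e in auto)
    also have "\<dots> = e" using B(1) C(1) by simp
    finally show ?thesis by (simp add: dist_norm P_def Q_def)
  qed
  then show "\<exists>H. pole_approx z\<^sub>0 M H \<and> (\<forall>z\<in>M. dist (F z * G z) (H z) \<le> e)"
    using pole_approx_poly[of z\<^sub>0 M "p * q"] by blast
qed

lemma pole_approx_power: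
  assumes M: "closed M" "z\<^sub>0 \<notin> M" and F: "pole_approx z\<^sub>0 M F"
  shows "pole_approx z\<^sub>0 M (\<lambda>z. F z ^ n)"
  by (induction n) (auto intro: pole_approx_const pole_approx_mult[OF M F])

text \<open>
  With \<open>u = (a - b) / (z - b)\<close> one has \<open>1 / (z - a) = (1 / (z - b)) * (1 / (1 - u))\<close>, and on \<open>M\<close> the
  geometric series in \<open>u\<close> converges uniformly because \<open>norm u \<le> 1/2\<close>.
\<close>
lemma pole_approx_move_pole:
  assumes M: "closed M" "z\<^sub>0 \<notin> M" and b: "pole_approx z\<^sub>0 M (\<lambda>z. 1 / (z - b))"
    and d: "d > 0" "\<And>z. z \<in> M \<Longrightarrow> d \<le> dist z b" and ab: "dist a b \<le> d/2"
  shows "pole_approx z\<^sub>0 M (\<lambda>z. 1 / (z - a))"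
proof (rule pole_approx_limit)
  fix e :: real assume e: "e > 0"
  have "e * d / 2 > 0" using e d(1) by simp
  then obtain N where N: "(1/2)^N < e * d / 2"
    using real_arch_pow_inv[of "e * d / 2" "1/2"] by auto
  define G where "G z = (\<Sum>k<N. (1 / (z - b)) * ((a - b) * (1 / (z - b))) ^ k)" for z
  have "pole_approx z\<^sub>0 M G"
    unfolding G_def
    by (intro pole_approx_sum pole_approx_mult[OF M] pole_approx_power[OF M] pole_approx_const b)
  moreover have "dist (1 / (z - a)) (G z) \<le> e" if z: "z \<in> M" for z
  proof -
    define u where "u = (a - b) * (1 / (z - b))"
    have zb: "d \<le> norm (z - b)" using d(2)[OF z] by (simp add: dist_norm)
    have za: "d/2 \<le> norm (z - a)"
      using d(2)[OF z] ab dist_triangle[of z b a] by (simp add: dist_norm)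
    have nz: "z - b \<noteq> 0" "z - a \<noteq> 0" using zb za d(1) by auto
    have u1: "1 - u = (z - a) / (z - b)"
      unfolding u_def using nz by (simp add: field_simps)
    have "norm u \<le> (d/2) / d"
      unfolding u_def using zb ab d(1)
      by (auto simp: norm_mult norm_divide dist_norm divide_simps intro: mult_mono)
    then have nu: "norm u \<le> 1/2" using d(1) by simp
    have "u \<noteq> 1" using u1 nz by auto
    then have "G z = (1 / (z - b)) * ((1 - u ^ N) / (1 - u))"
      unfolding G_def u_def[symmetric] sum_distrib_left[symmetric] by (simp add: sum_gp_strict)
    also have "\<dots> = (1 - u ^ N) / (z - a)"
      unfolding u1 using nz by simp
    finally have "1 / (z - a) - G z = u ^ N / (z - a)"
      by (simp add: diff_divide_distrib)
    then have "dist (1 / (z - a)) (G z) = norm u ^ N / norm (z - a)"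
      by (simp add: dist_norm norm_divide norm_power)
    also have "\<dots> \<le> (1/2) ^ N / (d/2)"
      using nu za d(1) by (intro frac_le power_mono) auto
    also have "\<dots> \<le> e" using N d(1) by (simp add: field_simps)
    finally show ?thesis .
  qed
  ultimately show "\<exists>G. pole_approx z\<^sub>0 M G \<and> (\<forall>z\<in>M. dist (1 / (z - a)) (G z) \<le> e)"
    by blast
qed

text \<open>
  Pole pushing: by the preceding lemma, near each point of the complement of \<open>M\<close> the property passes from one
  pole to any other, and the connected complement carries it from \<open>z\<^sub>0\<close> to \<open>a\<close>.
\<close>
lemma pole_approx_simple_pole:
  assumes M: "closed M" "z\<^sub>0 \<notin> M" "connected (-M)" and a: "a \<notin> M"
  shows "pole_approx z\<^sub>0 M (\<lambda>z. 1 / (z - a))"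
proof (rule connected_induction_simple[OF M(3), where P = "\<lambda>a. pole_approx z\<^sub>0 M (\<lambda>z. 1 / (z - a))"])
  show "z\<^sub>0 \<in> -M" "a \<in> -M" using M a by auto
  show "pole_approx z\<^sub>0 M (\<lambda>z. 1 / (z - z\<^sub>0))"
    using pole_approx_poly[of z\<^sub>0 M "[:0, 1:]"] by simp
next
  fix c assume "c \<in> -M"
  then obtain d where d: "d > 0" "\<forall>z\<in>M. d \<le> dist c z"
    using separate_point_closed[OF M(1)] by auto
  \<comment> \<open>The radius makes two points of the ball at most \<open>d/4\<close> apart, while each
      is at distance at least \<open>d/2\<close> from \<open>M\<close>, as moving a pole requires.\<close>
  let ?T = "ball c (d/8)"
  have "pole_approx z\<^sub>0 M (\<lambda>z. 1 / (z - y))"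
    if x: "x \<in> ?T" and y: "y \<in> ?T" and P: "pole_approx z\<^sub>0 M (\<lambda>z. 1 / (z - x))" for x y
  proof (rule pole_approx_move_pole[OF M(1,2) P, of "d/2"])
    show "d/2 > 0" using d by simp
    show "d/2 \<le> dist z x" if "z \<in> M" for z
    proof -
      have "d \<le> dist c z" using d that by blast
      then show ?thesis
        using x d(1) dist_triangle[of c z x] dist_commute[of x z] by (simp only: mem_ball)
    qed
    show "dist y x \<le> d/2/2"
      using x y dist_triangle3[of y x c] by (simp only: mem_ball)
  qed
  moreover have "?T \<subseteq> -M"
  proof
    fix x assume "x \<in> ?T"
    then show "x \<in> -M" using d by force
  qed
  then have "openin (top_of_set (-M)) ?T"
    by (intro openin_open_subtopology[THEN iffD2]) (use M in auto)
  moreover have "c \<in> ?T" using d by simp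
  ultimately show "\<exists>T. openin (top_of_set (-M)) T \<and> c \<in> T \<and>
      (\<forall>x\<in>T. \<forall>y\<in>T. pole_approx z\<^sub>0 M (\<lambda>z. 1 / (z - x)) \<longrightarrow> pole_approx z\<^sub>0 M (\<lambda>z. 1 / (z - y)))"
    by blast
qed

section \<open>Cauchy integrals as limits of rational functions\<close>

lemma integral_Riemann_sum_error:
  fixes F :: "real \<Rightarrow> complex"
  assumes F: "continuous_on {0..1} F" and n: "n > 0"
    and osc: "\<And>s t. \<lbrakk>s \<in> {0..1}; t \<in> {0..1}; \<bar>s - t\<bar> \<le> 1 / real n\<rbrakk> \<Longrightarrow> norm (F s - F t) \<le> e"
  shows "norm (integral {0..1} F - (\<Sum>j<n. F (real j / real n) / of_nat n)) \<le> e"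
proof -
  have "norm (integral {0..real k / real n} F - (\<Sum>j<k. F (real j / real n) / of_nat n)) \<le> e * (real k / real n)"
    if "k \<le> n" for k
    using that
  proof (induction k)
    case (Suc k)
    let ?a = "real k / real n" and ?b = "real (Suc k) / real n"
    have ab: "0 \<le> ?a" "?a \<le> ?b" "?b \<le> 1" "?b - ?a = 1 / real n"
      using Suc.prems n by (auto simp: field_simps)
    have cont: "continuous_on S F" if "S \<subseteq> {0..1}" for S
      using F that by (rule continuous_on_subset)
    have int: "F integrable_on {0..?b}" "F integrable_on {?a..?b}"
    proof -
      have "{0..?b} \<subseteq> {0..1}" "{?a..?b} \<subseteq> {0..1}"
        using ab(1,3) by (meson atLeastatMost_subset_iff order_refl)+
      then show "F integrable_on {0..?b}" "F integrable_on {?a..?b}"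
        by (blast intro: integrable_continuous_real cont)+
    qed
    have split: "integral {0..?b} F = integral {0..?a} F + integral {?a..?b} F"
      using Henstock_Kurzweil_Integration.integral_combine[OF ab(1,2) int(1)] by simp
    have "integral {?a..?b} (\<lambda>t. F t - F ?a) = integral {?a..?b} F - F ?a / of_nat n"
      using int(2) ab by (subst Henstock_Kurzweil_Integration.integral_diff)
        (auto simp: scaleR_conv_of_real divide_simps)
    moreover have "norm (integral {?a..?b} (\<lambda>t. F t - F ?a)) \<le> e * (?b - ?a)"
    proof (rule integral_bound)
      have sub: "{?a..?b} \<subseteq> {0..1}" using ab(1,3) by (meson atLeastatMost_subset_iff)
      show "continuous_on {?a..?b} (\<lambda>t. F t - F ?a)"
        by (intro continuous_intros cont sub)
      fix t assume t: "t \<in> {?a..?b}"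
      moreover have "?a \<in> {?a..?b}" using ab(2) by (simp only: atLeastAtMost_iff order_refl)
      moreover have "\<bar>t - ?a\<bar> \<le> 1 / real n"
        using t unfolding ab(4)[symmetric] atLeastAtMost_iff by linarith
      ultimately show "norm (F t - F ?a) \<le> e" using sub by (intro osc) blast+
    qed (rule ab(2))
    ultimately have step: "norm (integral {?a..?b} F - F ?a / of_nat n) \<le> e * (1 / real n)"
      using ab(4) by simp
    have "norm (integral {0..?b} F - (\<Sum>j<Suc k. F (real j / real n) / of_nat n)) =
        norm ((integral {0..?a} F - (\<Sum>j<k. F (real j / real n) / of_nat n))
          + (integral {?a..?b} F - F ?a / of_nat n))"
      unfolding split by (simp add: algebra_simps)
    also have "\<dots> \<le> e * ?a + e * (1 / real n)"
      using Suc.IH Suc.prems step by (intro norm_triangle_mono) auto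
    also have "\<dots> = e * ?b" using n by (simp add: field_simps)
    finally show ?case .
  qed simp
  from this[of n] show ?thesis using n by simp
qed

text \<open>
  The modulus of continuity in \<open>t\<close> is uniform over \<open>M\<close>, so the Riemann sums of the integral converge
  uniformly on \<open>M\<close>, and they are linear combinations of functions \<open>F t\<close>.
\<close>
lemma pole_approx_integral:
  fixes F :: "real \<Rightarrow> complex \<Rightarrow> complex"
  assumes F: "\<And>t. t \<in> {0..1} \<Longrightarrow> pole_approx z\<^sub>0 M (F t)"
    and equi: "\<And>e. e > 0 \<Longrightarrow> \<exists>d>0. \<forall>s\<in>{0..1}. \<forall>t\<in>{0..1}. \<bar>s - t\<bar> < d \<longrightarrow> (\<forall>z\<in>M. norm (F s z - F t z) \<le> e)"
    and M: "closed M" "z\<^sub>0 \<notin> M"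
  shows "pole_approx z\<^sub>0 M (\<lambda>z. integral {0..1} (\<lambda>t. F t z))"
proof (rule pole_approx_limit)
  fix e :: real assume "e > 0"
  then obtain d where d: "d > 0"
      "\<And>s t z. \<lbrakk>s \<in> {0..1}; t \<in> {0..1}; \<bar>s - t\<bar> < d; z \<in> M\<rbrakk> \<Longrightarrow> norm (F s z - F t z) \<le> e"
    using equi[of e] by blast
  obtain n :: nat where n: "n > 0" "1 / real n < d"
    using d(1) by (metis inverse_eq_divide reals_Archimedean zero_less_Suc)
  define G where "G z = (\<Sum>j<n. F (real j / real n) z * (1 / of_nat n))" for z
  have "pole_approx z\<^sub>0 M G"
    unfolding G_def by (intro pole_approx_sum pole_approx_mult[OF M] F pole_approx_const) auto
  moreover have "dist (integral {0..1} (\<lambda>t. F t z)) (G z) \<le> e" if z: "z \<in> M" for z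
  proof -
    have "continuous_on {0..1} (\<lambda>t. F t z)"
      unfolding continuous_on_iff
    proof (intro ballI allI impI)
      fix s r :: real assume s: "s \<in> {0..1}" and r: "r > 0"
      then obtain d' where d': "d' > 0"
          "\<And>s t z. \<lbrakk>s \<in> {0..1}; t \<in> {0..1}; \<bar>s - t\<bar> < d'; z \<in> M\<rbrakk> \<Longrightarrow> norm (F s z - F t z) \<le> r/2"
        using equi[of "r/2"] by (metis half_gt_zero)
      have "dist (F t z) (F s z) < r" if "t \<in> {0..1}" "dist t s < d'" for t
        using d'(2)[of t s z] that s z r by (simp add: dist_norm)
      then show "\<exists>d>0. \<forall>t\<in>{0..1}. dist t s < d \<longrightarrow> dist (F t z) (F s z) < r"
        using d'(1) by blast
    qed
    then have "norm (integral {0..1} (\<lambda>t. F t z) - (\<Sum>j<n. F (real j / real n) z / of_nat n)) \<le> e"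
      by (rule integral_Riemann_sum_error[OF _ n(1)]) (use d(2) n(2) z in auto)
    then show ?thesis by (simp add: dist_norm G_def)
  qed
  ultimately show "\<exists>G. pole_approx z\<^sub>0 M G \<and> (\<forall>z\<in>M. dist (integral {0..1} (\<lambda>t. F t z)) (G z) \<le> e)"
    by blast
qed

lemma pole_approx_Cauchy_integral:
  fixes a c :: "real \<Rightarrow> complex"
  assumes M: "closed M" "z\<^sub>0 \<notin> M" "connected (-M)"
    and a: "continuous_on {0..1} a" "a ` {0..1} \<inter> M = {}" and c: "continuous_on {0..1} c"
  shows "pole_approx z\<^sub>0 M (\<lambda>z. integral {0..1} (\<lambda>t. c t / (a t - z)))"
proof (rule pole_approx_integral[OF _ _ M(1,2)])
  fix t :: real assume t: "t \<in> {0..1}"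
  have "pole_approx z\<^sub>0 M (\<lambda>z. - c t * (1 / (z - a t)))"
    using a(2) t by (intro pole_approx_mult[OF M(1,2)] pole_approx_const pole_approx_simple_pole[OF M]) blast
  moreover have "- c t * (1 / (z - a t)) = c t / (a t - z)" for z
    by (metis minus_diff_eq minus_divide_divide mult.right_neutral times_divide_eq_right)
  ultimately show "pole_approx z\<^sub>0 M (\<lambda>z. c t / (a t - z))" by simp
next
  fix e :: real assume e: "e > 0"
  have "compact (a ` {0..1})" using a(1) by (intro compact_continuous_image) auto
  then obtain r where r: "r > 0" "\<forall>x\<in>a ` {0..1}. \<forall>z\<in>M. r \<le> dist x z"
    using separate_compact_closed[OF _ M(1) a(2)] by blast
  have "compact (c ` {0..1})" using c by (intro compact_continuous_image) auto
  then obtain B where B: "B > 0" "\<forall>x\<in>c ` {0..1}. norm x \<le> B"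
    using compact_imp_bounded bounded_pos by metis
  have uc: "uniformly_continuous_on {0..1} a" "uniformly_continuous_on {0..1} c"
    using a(1) c by (auto intro: compact_uniformly_continuous)
  have pos: "e * r / 2 > 0" "e * r\<^sup>2 / (2 * B) > 0" using e r(1) B(1) by auto
  obtain d1 where d1: "d1 > 0" "\<forall>s\<in>{0..1}. \<forall>t\<in>{0..1}. dist t s < d1 \<longrightarrow> dist (c t) (c s) < e * r / 2"
    using uc(2) pos(1) unfolding uniformly_continuous_on_def by blast
  obtain d2 where d2: "d2 > 0" "\<forall>s\<in>{0..1}. \<forall>t\<in>{0..1}. dist t s < d2 \<longrightarrow> dist (a t) (a s) < e * r\<^sup>2 / (2 * B)"
    using uc(1) pos(2) unfolding uniformly_continuous_on_def by blast
  have "norm (c s / (a s - z) - c t / (a t - z)) \<le> e"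
    if st: "s \<in> {0..1}" "t \<in> {0..1}" "\<bar>s - t\<bar> < min d1 d2" and z: "z \<in> M" for s t z
  proof -
    have ra: "r \<le> norm (a s - z)" "r \<le> norm (a t - z)"
      using r(2) st z by (auto simp: dist_norm)
    have nz: "a s - z \<noteq> 0" "a t - z \<noteq> 0" using ra r(1) by auto
    have "dist s t < d1" "dist s t < d2" using st(3) by (auto simp: dist_real_def)
    then have dc: "norm (c s - c t) \<le> e * r / 2" and da: "norm (a t - a s) \<le> e * r\<^sup>2 / (2 * B)"
      using d1(2) d2(2) st by (auto simp: dist_norm norm_minus_commute less_imp_le)
    have "c s / (a s - z) - c t / (a t - z) =
        (c s - c t) / (a s - z) + c t * ((a t - a s) / ((a s - z) * (a t - z)))"
    proof -
      have "p / x - q / y = (p - q) / x + q * ((y - x) / (x * y))"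
        if "x \<noteq> 0" "y \<noteq> 0" for p q x y :: complex
        using that by (simp add: field_simps)
      from this[OF nz, of "c s" "c t"] show ?thesis by simp
    qed
    then have "norm (c s / (a s - z) - c t / (a t - z)) \<le>
        norm (c s - c t) / norm (a s - z) +
        norm (c t) * (norm (a t - a s) / (norm (a s - z) * norm (a t - z)))"
      by (metis norm_divide norm_mult norm_triangle_ineq)
    also have "\<dots> \<le> (e * r / 2) / r + B * ((e * r\<^sup>2 / (2 * B)) / (r * r))"
      using dc da ra r(1) B st pos e by (intro add_mono frac_le mult_mono) auto
    also have "\<dots> = e" using r(1) B(1) by (simp add: field_simps power2_eq_square)
    finally show ?thesis .
  qed
  then show "\<exists>d>0. \<forall>s\<in>{0..1}. \<forall>t\<in>{0..1}. \<bar>s - t\<bar> < d \<longrightarrow>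
      (\<forall>z\<in>M. norm (c s / (a s - z) - c t / (a t - z)) \<le> e)"
    using d1(1) d2(1) by (intro exI[of _ "min d1 d2"]) auto
qed

text \<open>
  This is Cauchy's formula for \<open>H \<circ> inv \<psi>\<close> on the curve \<open>\<psi> ` sphere 0 r\<close>, pulled back to the disc by the
  substitution \<open>w = \<psi> u\<close>. Working in the disc, the only singularity is at \<open>v\<close>, a simple pole because the
  injective map \<open>\<psi>\<close> has non-vanishing derivative, so the formula for circles applies.
\<close>
lemma contour_integral_conformal_disc_inside:
  assumes \<psi>: "\<psi> holomorphic_on ball 0 1" "inj_on \<psi> (ball 0 1)" and H: "H holomorphic_on ball 0 1"
    and r: "r < 1" and v: "norm v < r"
  shows "contour_integral (circlepath 0 r) (\<lambda>u. H u * deriv \<psi> u / (\<psi> u - \<psi> v)) = 2 * of_real pi * \<i> * H v"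
proof -
  \<comment> \<open>\<open>Q\<close> is the difference quotient of \<open>\<psi>\<close> at \<open>v\<close>; it is holomorphic and has no zeros.\<close>
  define Q where "Q u = (if u = v then deriv \<psi> v else (\<psi> u - \<psi> v) / (u - v))" for u
  have Q: "Q holomorphic_on ball 0 1"
    unfolding Q_def by (rule pole_lemma_open[OF \<psi>(1)]) simp
  have vb: "v \<in> ball 0 1" using r v by simp
  have dv: "deriv \<psi> v \<noteq> 0"
    using holomorphic_injective_imp_regular[OF \<psi>(1) _ \<psi>(2) vb] by simp
  have Q0: "Q u \<noteq> 0" if "u \<in> ball 0 1" for u
    using dv inj_onD[OF \<psi>(2), of u v] that vb by (auto simp: Q_def)
  let ?G = "\<lambda>u. H u * deriv \<psi> u / Q u"
  have sub: "cball 0 r \<subseteq> ball (0::complex) 1" using r by auto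
  have G: "?G holomorphic_on ball 0 1"
    using Q0 by (intro holomorphic_intros H Q \<psi>(1)) auto
  have "((\<lambda>u. ?G u / (u - v)) has_contour_integral (2 * of_real pi * \<i>) * ?G v) (circlepath 0 r)"
    by (rule Cauchy_integral_circlepath_simple) (use holomorphic_on_subset[OF G sub] v in auto)
  moreover have "?G v = H v" using dv by (simp add: Q_def)
  moreover have "?G u / (u - v) = H u * deriv \<psi> u / (\<psi> u - \<psi> v)" if "u \<in> path_image (circlepath 0 r)" for u
  proof -
    have "0 \<le> r" using v norm_ge_zero[of v] by linarith
    then have "norm u = r" using that by (auto simp: path_image_circlepath_nonneg)
    then have "u \<noteq> v" using v by auto
    then show ?thesis by (simp add: Q_def)
  qed
  ultimately have "((\<lambda>u. H u * deriv \<psi> u / (\<psi> u - \<psi> v)) has_contour_integral 2 * of_real pi * \<i> * H v) (circlepath 0 r)"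
    using has_contour_integral_eq by (metis (no_types, lifting))
  then show ?thesis by (rule contour_integral_unique)
qed

text \<open>
  Off the image of the closed disc the integrand has no singularity. The Cauchy integral thus
  represents \<open>H \<circ> inv \<psi>\<close> inside the curve and \<open>0\<close> outside, which is what makes simultaneous approximation
  on disjoint sets possible.
\<close>
lemma contour_integral_conformal_disc_outside:
  assumes \<psi>: "\<psi> holomorphic_on ball 0 1" and H: "H holomorphic_on ball 0 1"
    and r: "0 \<le> r" "r < 1" and z: "z \<notin> \<psi> ` cball 0 r"
  shows "contour_integral (circlepath 0 r) (\<lambda>u. H u * deriv \<psi> u / (\<psi> u - z)) = 0"
proof -
  have sub: "cball 0 r \<subseteq> ball (0::complex) 1" using r by auto
  have "deriv \<psi> holomorphic_on ball 0 1" by (intro holomorphic_intros \<psi>) auto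
  then have "(\<lambda>u. H u * deriv \<psi> u / (\<psi> u - z)) holomorphic_on cball 0 r"
    using z by (intro holomorphic_intros holomorphic_on_subset[OF _ sub] H \<psi>) auto
  then have "((\<lambda>u. H u * deriv \<psi> u / (\<psi> u - z)) has_contour_integral 0) (circlepath 0 r)"
    using r by (intro Cauchy_theorem_convex_simple[OF _ convex_cball[of 0 r]]) (auto simp: path_image_circlepath_nonneg)
  then show ?thesis by (rule contour_integral_unique)
qed

lemma pole_approx_conformal_disc_integral:
  assumes M: "closed M" "z\<^sub>0 \<notin> M" "connected (-M)"
    and \<psi>: "\<psi> holomorphic_on ball 0 1" and H: "H holomorphic_on ball 0 1"
    and r: "0 \<le> r" "r < 1" and disj: "\<psi> ` sphere 0 r \<inter> M = {}"
  shows "pole_approx z\<^sub>0 M (\<lambda>z. contour_integral (circlepath 0 r) (\<lambda>u. H u * deriv \<psi> u / (\<psi> u - z)))"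
proof -
  have d: "deriv \<psi> holomorphic_on ball 0 1" by (intro holomorphic_intros \<psi>) auto
  have im: "circlepath 0 r ` {0..1} = sphere 0 r"
    using path_image_circlepath_nonneg[OF r(1), of 0] by (simp add: path_image_def)
  have sub: "circlepath 0 r ` {0..1} \<subseteq> ball 0 1" unfolding im using r by auto
  have cp: "continuous_on {0..1} (circlepath 0 r)"
    using path_circlepath[of 0 r] by (simp add: path_def)
  have comp: "continuous_on {0..1} (\<lambda>t. g (circlepath 0 r t))" if "g holomorphic_on ball 0 1" for g
    using holomorphic_on_imp_continuous_on[OF that] cp sub by (rule continuous_on_compose2)
  have "pole_approx z\<^sub>0 M (\<lambda>z. integral {0..1} (\<lambda>t.
      (H (circlepath 0 r t) * deriv \<psi> (circlepath 0 r t) * (2 * of_real pi * \<i> * r * exp (2 * of_real pi * \<i> * t)))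
        / (\<psi> (circlepath 0 r t) - z)))"
  proof (rule pole_approx_Cauchy_integral[OF M])
    show "(\<lambda>t. \<psi> (circlepath 0 r t)) ` {0..1} \<inter> M = {}"
      using disj im by (metis image_image)
    show "continuous_on {0..1} (\<lambda>t. H (circlepath 0 r t) * deriv \<psi> (circlepath 0 r t) *
        (2 * of_real pi * \<i> * r * exp (2 * of_real pi * \<i> * t)))"
      by (intro continuous_intros comp H d)
  qed (rule comp[OF \<psi>])
  moreover have "contour_integral (circlepath 0 r) (\<lambda>u. H u * deriv \<psi> u / (\<psi> u - z)) =
     integral {0..1} (\<lambda>t.
      (H (circlepath 0 r t) * deriv \<psi> (circlepath 0 r t) * (2 * of_real pi * \<i> * r * exp (2 * of_real pi * \<i> * t)))
        / (\<psi> (circlepath 0 r t) - z))" for z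
    unfolding contour_integral_integral
    by (intro integral_cong) (simp add: vector_derivative_circlepath)
  ultimately show ?thesis by simp
qed

section \<open>Simultaneous Runge approximation on conformal discs\<close>

text \<open>
  Induction on \<open>I\<close> by Janiszewski's theorem, whose hypothesis on the intersection is trivial for disjoint
  sets.
\<close>
lemma connected_complement_Un_discs:
  fixes D :: "'i \<Rightarrow> complex set"
  assumes "finite I" "closed T" "connected (-T)"
    and "\<And>i. i \<in> I \<Longrightarrow> compact (D i) \<and> connected (- D i) \<and> D i \<inter> T = {}"
    and "disjoint_family_on D I"
  shows "connected (- (T \<union> (\<Union>i\<in>I. D i)))"
  using assms
proof (induction I rule: finite_induct)
  case (insert i I)
  have dis: "D i \<inter> (T \<union> (\<Union>i\<in>I. D i)) = {}"
    using insert.prems insert.hyps by (fastforce simp: disjoint_family_on_def)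
  have con: "connected (- (T \<union> (\<Union>i\<in>I. D i)))"
    using insert.prems by (intro insert.IH) (auto simp: disjoint_family_on_def)
  have clo: "closed (T \<union> (\<Union>i\<in>I. D i))"
    using insert.prems insert.hyps by (intro closed_Un closed_UN) (auto intro: compact_imp_closed)
  have "connected (- (D i \<union> (T \<union> (\<Union>i\<in>I. D i))))"
    by (rule Janiszewski_connected[OF _ clo _ _ con]) (use insert.prems dis in simp_all)
  moreover have "D i \<union> (T \<union> (\<Union>i\<in>I. D i)) = T \<union> (\<Union>i\<in>insert i I. D i)" by blast
  ultimately show ?case by simp
qed simp

lemma connected_complement_conformal_disc:
  assumes "\<psi> holomorphic_on ball 0 1" "inj_on \<psi> (ball 0 1)" "r < 1"
  shows "compact (\<psi> ` cball 0 r)" "connected (- \<psi> ` cball 0 r)"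
proof -
  have sub: "cball 0 r \<subseteq> ball (0::complex) 1" using assms(3) by auto
  have c: "continuous_on (cball 0 r) \<psi>"
    using holomorphic_on_imp_continuous_on[OF assms(1)] sub by (rule continuous_on_subset)
  then show "compact (\<psi> ` cball 0 r)" by (intro compact_continuous_image) auto
  have "cball (0::complex) r homeomorphic \<psi> ` cball 0 r"
    using compact_cball c refl inj_on_subset[OF assms(2) sub] by (rule homeomorphic_compact)
  then have "\<psi> ` cball 0 r homeomorphic cball (0::complex) r"
    by (rule homeomorphic_sym[THEN iffD1])
  then show "connected (- \<psi> ` cball 0 r)"
    by (rule connected_complement_homeomorphic_convex_compact) simp_all
qed

text \<open>
  The sum of the normalized Cauchy integrals of the \<open>H i\<close> over the curves \<open>\<psi> i ` sphere 0 r'\<close> equals \<open>0\<close> on \<open>T\<close> and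
  \<open>H i u\<close> at \<open>\<psi> i u\<close> for \<open>norm u \<le> r\<close>. The curves lie in the connected complement of the set \<open>M\<close> on which the approximation takes
  place, so all poles can be pushed to \<open>z\<^sub>0\<close>.
\<close>
theorem simultaneous_Runge:
  fixes \<psi> H :: "'i \<Rightarrow> complex \<Rightarrow> complex"
  assumes I: "finite I" and T: "closed T" "connected (-T)" and z\<^sub>0: "z\<^sub>0 \<notin> T"
    and \<psi>: "\<And>i. i \<in> I \<Longrightarrow> \<psi> i holomorphic_on ball 0 1" "\<And>i. i \<in> I \<Longrightarrow> inj_on (\<psi> i) (ball 0 1)"
    and z\<^sub>0\<psi>: "\<And>i. i \<in> I \<Longrightarrow> z\<^sub>0 \<notin> \<psi> i ` ball 0 1"
    and disj: "disjoint_family_on (\<lambda>i. \<psi> i ` ball 0 1) I"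
    and H: "\<And>i. i \<in> I \<Longrightarrow> H i holomorphic_on ball 0 1"
    and r: "0 < r" "r < r'" "r' < 1" and \<psi>T: "\<And>i. i \<in> I \<Longrightarrow> \<psi> i ` cball 0 r' \<inter> T = {}"
    and e: "e > 0"
  obtains p where "\<And>z. z \<in> T \<Longrightarrow> norm (poly p (1 / (z - z\<^sub>0))) < e"
    "\<And>i u. i \<in> I \<Longrightarrow> norm u \<le> r \<Longrightarrow> dist (poly p (1 / (\<psi> i u - z\<^sub>0))) (H i u) < e"
proof -
  define M where "M = T \<union> (\<Union>i\<in>I. \<psi> i ` cball 0 r)"
  have r1: "r < 1" using r by simp
  have subr: "cball 0 r \<subseteq> ball (0::complex) 1" using r by auto
  have cc: "compact (\<psi> i ` cball 0 r)" "connected (- \<psi> i ` cball 0 r)" if "i \<in> I" for i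
    using connected_complement_conformal_disc[OF \<psi>(1,2) r1] that by auto
  have disjr: "disjoint_family_on (\<lambda>i. \<psi> i ` cball 0 r) I"
    unfolding disjoint_family_on_def
  proof (intro ballI impI)
    fix i j assume "i \<in> I" "j \<in> I" "i \<noteq> j"
    then have "\<psi> i ` ball 0 1 \<inter> \<psi> j ` ball 0 1 = {}"
      using disj unfolding disjoint_family_on_def by blast
    then show "\<psi> i ` cball 0 r \<inter> \<psi> j ` cball 0 r = {}"
      using image_mono[OF subr, of "\<psi> i"] image_mono[OF subr, of "\<psi> j"] by blast
  qed
  have \<psi>Tr: "\<psi> i ` cball 0 r \<inter> T = {}" if "i \<in> I" for i
  proof -
    have "cball 0 r \<subseteq> cball (0::complex) r'" using r by auto
    then show ?thesis using \<psi>T[OF that] by blast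
  qed
  have M: "closed M" "z\<^sub>0 \<notin> M" "connected (-M)"
  proof -
    show "closed M" unfolding M_def using T I cc
      by (intro closed_Un closed_UN) (auto intro: compact_imp_closed)
    show "z\<^sub>0 \<notin> M" unfolding M_def using z\<^sub>0 z\<^sub>0\<psi> subr by blast
    show "connected (-M)" unfolding M_def
      using cc \<psi>Tr by (intro connected_complement_Un_discs I T disjr) auto
  qed
  define J where "J i z = contour_integral (circlepath 0 r') (\<lambda>u. H i u * deriv (\<psi> i) u / (\<psi> i u - z))" for i z
  define G where "G z = (\<Sum>i\<in>I. J i z * (1 / (2 * of_real pi * \<i>)))" for z
  have "pole_approx z\<^sub>0 M (J i)" if i: "i \<in> I" for i
    unfolding J_def
  proof (rule pole_approx_conformal_disc_integral[OF M \<psi>(1)[OF i] H[OF i]])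
    show "\<psi> i ` sphere 0 r' \<inter> M = {}"
    proof -
      have "\<psi> i u \<noteq> \<psi> j v" if "u \<in> sphere 0 r'" "j \<in> I" "v \<in> cball 0 r" for j u v
      proof
        assume eq: "\<psi> i u = \<psi> j v"
        have uv: "u \<in> ball 0 1" "v \<in> ball 0 1" "u \<noteq> v" using that r by auto
        show False
        proof (cases "i = j")
          case True
          then show False using inj_onD[OF \<psi>(2)[OF i], of u v] eq uv by simp
        next
          case False
          then have "\<psi> i ` ball 0 1 \<inter> \<psi> j ` ball 0 1 = {}"
            using disj i that(2) unfolding disjoint_family_on_def by blast
          then show False using eq uv by blast
        qed
      qed
      moreover have "\<psi> i ` sphere 0 r' \<inter> T = {}"
        using \<psi>T[OF i] image_mono[OF sphere_cball[of 0 r'], of "\<psi> i"] by blast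
      ultimately show ?thesis unfolding M_def by blast
    qed
  qed (use r in auto)
  then have G: "pole_approx z\<^sub>0 M G"
    unfolding G_def by (intro pole_approx_sum pole_approx_mult[OF M(1,2)] pole_approx_const)
  have J0: "J i z = 0" if "i \<in> I" "z \<notin> \<psi> i ` cball 0 r'" for i z
    unfolding J_def using r that by (intro contour_integral_conformal_disc_outside \<psi>(1) H) auto
  have GT: "G z = 0" if "z \<in> T" for z
    unfolding G_def
  proof (intro sum.neutral ballI)
    fix i assume "i \<in> I"
    then have "J i z = 0" using J0[of i z] \<psi>T[of i] that by blast
    then show "J i z * (1 / (2 * of_real pi * \<i>)) = 0" by simp
  qed
  have G\<psi>: "G (\<psi> i u) = H i u" if i: "i \<in> I" and u: "norm u \<le> r" for i u
  proof -
    have "J j (\<psi> i u) = 0" if j: "j \<in> I - {i}" for j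
    proof (rule J0)
      have "\<psi> i ` ball 0 1 \<inter> \<psi> j ` ball 0 1 = {}"
        using disj i j unfolding disjoint_family_on_def by blast
      moreover have "\<psi> i u \<in> \<psi> i ` ball 0 1" using u r by (intro imageI) auto
      moreover have "\<psi> j ` cball 0 r' \<subseteq> \<psi> j ` ball 0 1" using r by (intro image_mono) auto
      ultimately show "\<psi> i u \<notin> \<psi> j ` cball 0 r'" by blast
    qed (use j in simp)
    then have "G (\<psi> i u) = J i (\<psi> i u) * (1 / (2 * of_real pi * \<i>))"
      unfolding G_def using i I by (subst sum.remove[of _ i]) auto
    also have "J i (\<psi> i u) = 2 * of_real pi * \<i> * H i u"
      unfolding J_def using r u i by (intro contour_integral_conformal_disc_inside \<psi> H) auto
    finally show ?thesis by simp
  qed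
  obtain p where p: "\<forall>z\<in>M. dist (G z) (poly p (1 / (z - z\<^sub>0))) < e"
    using G e unfolding pole_approx_def by blast
  show ?thesis
  proof (rule that)
    show "norm (poly p (1 / (z - z\<^sub>0))) < e" if "z \<in> T" for z
    proof -
      have "z \<in> M" using that by (simp add: M_def)
      then show ?thesis using p GT[OF that] by (metis dist_0_norm)
    qed
    show "dist (poly p (1 / (\<psi> i u - z\<^sub>0))) (H i u) < e" if "i \<in> I" "norm u \<le> r" for i u
    proof -
      have "\<psi> i u \<in> \<psi> i ` cball 0 r" using that by (intro imageI) simp
      then have "\<psi> i u \<in> M" unfolding M_def using that(1) by blast
      then show ?thesis using p G\<psi>[OF that] by (metis dist_commute)
    qed
  qed
qed

section \<open>Open sets without holes\<close>

text \<open>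
  The component of \<open>x\<close> in the complement of \<open>W\<close> on the sphere contains \<open>\<infinity>\<close>. The winding number
  of \<open>g\<close> is locally constant off the curve and \<open>0\<close> near \<open>\<infinity>\<close>, so if it were non-zero at \<open>x\<close>, then the
  points with zero and with non-zero winding number would disconnect this component.
\<close>
lemma no_holes_winding_number_zero:
  assumes holes: "holes W = {}" and g: "path g" "pathfinish g = pathstart g" "path_image g \<subseteq> W"
    and x: "x \<notin> W"
  shows "winding_number g x = 0"
proof (rule ccontr)
  assume wx: "winding_number g x \<noteq> 0"
  define P where "P = {z. z \<notin> path_image g \<and> winding_number g z = 0}"
  define N where "N = (\<Union>k\<in>-{0}. {z. z \<notin> path_image g \<and> winding_number g z = k})"
  have P: "open P" unfolding P_def by (rule open_winding_number_levelsets[OF g(1,2)])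
  have N: "open N" unfolding N_def by (intro open_UN ballI open_winding_number_levelsets[OF g(1,2)])
  obtain R where R: "\<And>z. R \<le> norm z \<Longrightarrow> winding_number g z = 0"
    using winding_number_zero_at_infinity[OF g(1,2)] by blast
  have "- P \<subseteq> path_image g \<union> cball 0 R"
    using R by (force simp: P_def)
  moreover have "bounded (path_image g \<union> cball 0 R)"
    using g(1) by (simp add: bounded_path_image)
  ultimately have "bounded (-P)" by (rule bounded_subset[rotated])
  moreover have "closed (-P)" using P by (simp add: closed_Compl)
  ultimately have "compact (-P)" by (simp only: compact_eq_bounded_closed)
  then have E2: "openin riemann_sphere (insert None (Some ` P))"
    unfolding riemann_sphere_def openin_Alexandroff_compactification
    using P by (intro disjI2 exI[of _ "-P"]) auto
  have E1: "openin riemann_sphere (Some ` N)"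
    using N by (simp add: riemann_sphere_def)
  have ts: "topspace riemann_sphere = UNIV"
    by (auto simp: riemann_sphere_def intro: option.exhaust)
  let ?X = "subtopology riemann_sphere (UNIV - Some ` W)"
  let ?H = "connected_component_of_set ?X (Some x)"
  have xX: "Some x \<in> topspace ?X" using x by (auto simp: ts)
  have "?H \<in> connected_components_of ?X"
    using xX by (simp add: connected_component_in_connected_components_of)
  then have "None \<in> ?H" using holes unfolding holes_def by blast
  have Hx: "Some x \<in> ?H" using xX by (simp add: connected_component_of_refl)
  have "connectedin ?X ?H" by (rule connectedin_connected_component_of)
  then have H: "connectedin riemann_sphere ?H" "?H \<subseteq> UNIV - Some ` W"
    by (auto simp only: connectedin_subtopology)
  have cover: "?H \<subseteq> Some ` N \<union> insert None (Some ` P)"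
  proof
    fix y assume y: "y \<in> ?H"
    show "y \<in> Some ` N \<union> insert None (Some ` P)"
    proof (cases y)
      case (Some z)
      then have "z \<notin> W" using y H(2) by blast
      then have "z \<in> N \<union> P" using g(3) by (auto simp: N_def P_def)
      then show ?thesis using Some by blast
    qed simp
  qed
  have "N \<inter> P = {}" by (auto simp: N_def P_def)
  then have disj: "Some ` N \<inter> insert None (Some ` P) \<inter> ?H = {}" by auto
  have "x \<in> N" using wx x g(3) by (auto simp: N_def)
  then have "Some ` N \<inter> ?H \<noteq> {}" using Hx by blast
  moreover have "insert None (Some ` P) \<inter> ?H \<noteq> {}" using \<open>None \<in> ?H\<close> by blast
  ultimately show False
    using connectedinD[OF H(1) E1 E2 cover disj] by blast
qed

text \<open>
  Winding numbers of curves in \<open>C\<close> vanish off \<open>W\<close> by the previous lemma. At a point \<open>z\<close> of another component \<open>C'\<close>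
  the winding number is the constant value on \<open>C'\<close>, which agrees with the value at a frontier point of \<open>C'\<close>, and
  frontier points of components do not belong to \<open>W\<close>.
\<close>
lemma no_holes_component_simply_connected:
  assumes W: "open W" "holes W = {}" and C: "C \<in> components W"
  shows "simply_connected C"
proof -
  have "open C" using open_components[OF W(1) C] .
  moreover have "connected C" using C by (rule in_components_connected)
  moreover have "winding_number g z = 0"
    if g: "path g" "path_image g \<subseteq> C" "pathfinish g = pathstart g" and z: "z \<notin> C" for g z
  proof (cases "z \<in> W")
    case False
    then show ?thesis
      using no_holes_winding_number_zero[OF W(2) g(1,3) _ False] g(2) in_components_subset[OF C] by blast
  next
    case True
    define C' where "C' = connected_component_set W z"
    have zC': "z \<in> C'" using True by (simp add: C'_def connected_component_refl)
    have C': "C' \<in> components W" using True by (auto simp: C'_def components_def)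
    have dis: "C' \<inter> C = {}" using components_nonoverlap[OF C' C] zC' z by blast
    have "C \<noteq> {}" using in_components_nonempty[OF C] .
    then have "frontier C' \<noteq> {}" using dis zC' by (intro frontier_not_empty) auto
    then obtain y where y: "y \<in> frontier C'" by blast
    then have "y \<in> frontier W" using frontier_of_components_subset[OF C'] by blast
    then have yW: "y \<notin> W" using W(1) frontier_disjoint_eq by blast
    have gW: "path_image g \<subseteq> W" using g(2) in_components_subset[OF C] by blast
    let ?P = "{z. z \<notin> path_image g \<and> winding_number g z = 0}"
    have "y \<in> ?P"
      using no_holes_winding_number_zero[OF W(2) g(1,3) gW yW] gW yW by blast
    moreover have "open ?P" by (rule open_winding_number_levelsets[OF g(1,3)])
    moreover have "y \<in> closure C'" using y by (simp add: frontier_def)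
    ultimately have "?P \<inter> C' \<noteq> {}" by (metis open_Int_closure_eq_empty disjoint_iff)
    then obtain z' where z': "z' \<in> C'" "winding_number g z' = 0" by blast
    have "winding_number g constant_on C'"
      using g dis by (intro winding_number_constant in_components_connected[OF C']) auto
    then show ?thesis using z' zC' unfolding constant_on_def by metis
  qed
  ultimately show ?thesis
    by (subst simply_connected_eq_winding_number_zero) auto
qed

text \<open>
  The Riemann images of the open discs of radius less than \<open>1\<close>, over all components of \<open>W\<close>, cover \<open>K\<close>. A
  finite subcover involves finitely many components and has a largest radius. The set of components serves as the index
  set.
\<close>
lemma no_holes_Riemann_discs:
  assumes W: "open W" "holes W = {}" "W \<noteq> UNIV" and K: "compact K" "K \<subseteq> W"
  obtains \<C> \<psi> r where "finite \<C>" "\<C> \<subseteq> components W" "0 < r" "r < (1::real)"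
    "\<And>C. C \<in> \<C> \<Longrightarrow> \<psi> C holomorphic_on ball 0 1" "\<And>C. C \<in> \<C> \<Longrightarrow> inj_on (\<psi> C) (ball 0 1)"
    "\<And>C. C \<in> \<C> \<Longrightarrow> \<psi> C ` ball 0 1 = C"
    "K \<subseteq> (\<Union>C\<in>\<C>. \<psi> C ` cball 0 r)"
proof -
  have "\<exists>\<psi>. \<psi> holomorphic_on ball 0 1 \<and> inj_on \<psi> (ball 0 1) \<and> \<psi> ` ball 0 1 = C"
    if C: "C \<in> components W" for C
  proof -
    have "open C" "simply_connected C" "C \<noteq> {}" "C \<noteq> UNIV"
      using open_components[OF W(1) C] no_holes_component_simply_connected[OF W(1,2) C]
        in_components_nonempty[OF C] in_components_subset[OF C] W(3) by auto
    then obtain f g where fg: "g holomorphic_on ball 0 1" "\<forall>z\<in>C. f z \<in> ball 0 1 \<and> g (f z) = z"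
        "\<forall>z\<in>ball 0 1. g z \<in> C \<and> f (g z) = z"
      using Riemann_mapping_theorem[of C] by auto
    have "inj_on g (ball 0 1)" using fg(3) by (metis inj_onI)
    moreover have "g ` ball 0 1 = C" using fg(2,3) by force
    ultimately show ?thesis using fg(1) by blast
  qed
  then obtain \<psi> where \<psi>: "\<And>C. C \<in> components W \<Longrightarrow> \<psi> C holomorphic_on ball 0 1"
      "\<And>C. C \<in> components W \<Longrightarrow> inj_on (\<psi> C) (ball 0 1)"
      "\<And>C. C \<in> components W \<Longrightarrow> \<psi> C ` ball 0 1 = C"
    by metis
  define I where "I = components W \<times> {0<..<(1::real)}"
  define D where "D i = \<psi> (fst i) ` ball 0 (snd i)" for i
  have "open (D i)" if "i \<in> I" for i
  proof -
    have C: "fst i \<in> components W" and s: "ball 0 (snd i) \<subseteq> ball (0::complex) 1"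
      using that by (auto simp: I_def)
    show ?thesis unfolding D_def
      by (rule open_mapping_thm3[OF holomorphic_on_subset[OF \<psi>(1)[OF C] s] _ inj_on_subset[OF \<psi>(2)[OF C] s]]) simp
  qed
  moreover have "K \<subseteq> (\<Union>i\<in>I. D i)"
  proof
    fix z assume "z \<in> K"
    then obtain C where C: "C \<in> components W" "z \<in> C"
      using K(2) Union_components[of W] by blast
    then obtain u where u: "norm u < 1" "z = \<psi> C u" using \<psi>(3)[OF C(1)] by force
    then obtain s where s: "norm u < s" "s < 1" using dense by blast
    have "0 < s" using s(1) norm_ge_zero[of u] by linarith
    then have "(C, s) \<in> I" using C s by (simp add: I_def)
    moreover have "z \<in> D (C, s)" using u s by (auto simp: D_def)
    ultimately show "z \<in> (\<Union>i\<in>I. D i)" by blast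
  qed
  ultimately obtain I' where I': "I' \<subseteq> I" "finite I'" "K \<subseteq> (\<Union>i\<in>I'. D i)"
    using compactE_image[OF K(1), of I D] by metis
  define r where "r = Max (insert (1/2) (snd ` I'))"
  have fin: "finite (insert (1/2) (snd ` I'))" using I'(2) by simp
  have r: "0 < r" "r < 1"
  proof -
    have "1/2 \<le> r" unfolding r_def by (rule Max_ge[OF fin]) simp
    then show "0 < r" by simp
    have "r \<in> insert (1/2) (snd ` I')" unfolding r_def by (rule Max_in[OF fin]) simp
    then show "r < 1" using I'(1) by (auto simp: I_def)
  qed
  show ?thesis
  proof (rule that[of "fst ` I'" r \<psi>])
    show "fst ` I' \<subseteq> components W" using I'(1) by (auto simp: I_def)
    then show "\<psi> C holomorphic_on ball 0 1" "inj_on (\<psi> C) (ball 0 1)" "\<psi> C ` ball 0 1 = C"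
      if "C \<in> fst ` I'" for C using \<psi> that by blast+
    show "K \<subseteq> (\<Union>C\<in>fst ` I'. \<psi> C ` cball 0 r)"
    proof
      fix z assume "z \<in> K"
      then obtain i where i: "i \<in> I'" "z \<in> \<psi> (fst i) ` ball 0 (snd i)"
        using I'(3) unfolding D_def by blast
      have "snd i \<le> r" unfolding r_def using i(1) by (intro Max_ge[OF fin]) simp
      then have "ball 0 (snd i) \<subseteq> cball (0::complex) r" by auto
      then show "z \<in> (\<Union>C\<in>fst ` I'. \<psi> C ` cball 0 r)" using i by blast
    qed
  qed (use I' r in auto)
qed

text \<open>
  The set \<open>K'\<close> depends on \<open>K\<close> and \<open>W\<close> only. This order of quantifiers matters: the number \<open>n\<close> of iterations has to
  be chosen for \<open>K'\<close> before the approximation is applied with \<open>F = f ^^ n\<close>. Composing the Riemann maps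
  with \<open>F\<close> gives the conformal discs for \<open>simultaneous_Runge\<close>.
\<close>
lemma no_holes_Runge:
  assumes W: "open W" "holes W = {}" "W \<noteq> UNIV" and K: "compact K" "K \<subseteq> W"
  obtains K' where "compact K'" "K' \<subseteq> W"
    "\<And>F h T z\<^sub>0 e. \<lbrakk>F holomorphic_on W; inj_on F W; h holomorphic_on W; closed T; connected (-T);
        z\<^sub>0 \<notin> T; z\<^sub>0 \<notin> F ` W; F ` K' \<inter> T = {}; e > 0\<rbrakk> \<Longrightarrow>
      \<exists>p. (\<forall>z\<in>T. norm (poly p (1 / (z - z\<^sub>0))) < e) \<and>
          (\<forall>z\<in>K. dist (poly p (1 / (F z - z\<^sub>0))) (h z) < e)"
proof -
  obtain \<C> \<psi> r where C: "finite \<C>" "\<C> \<subseteq> components W" and r: "0 < r" "r < (1::real)"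
    and \<psi>: "\<And>C. C \<in> \<C> \<Longrightarrow> \<psi> C holomorphic_on ball 0 1" "\<And>C. C \<in> \<C> \<Longrightarrow> inj_on (\<psi> C) (ball 0 1)"
      "\<And>C. C \<in> \<C> \<Longrightarrow> \<psi> C ` ball 0 1 = C"
    and cov: "K \<subseteq> (\<Union>C\<in>\<C>. \<psi> C ` cball 0 r)"
    by (rule no_holes_Riemann_discs[OF assms]) (rule that)
  obtain r' where r': "r < r'" "r' < 1" using dense[OF r(2)] by blast
  have sub: "cball 0 r' \<subseteq> ball (0::complex) 1" using r' by auto
  have CW: "C \<subseteq> W" if "C \<in> \<C>" for C using in_components_subset that C(2) by blast
  define K' where "K' = (\<Union>C\<in>\<C>. \<psi> C ` cball 0 r')"
  show ?thesis
  proof (rule that[of K'])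
    show "compact K'"
      unfolding K'_def
      by (intro compact_UN C(1) connected_complement_conformal_disc(1) \<psi> r') auto
    show "K' \<subseteq> W"
    proof -
      have "\<psi> C ` cball 0 r' \<subseteq> W" if "C \<in> \<C>" for C
        using image_mono[OF sub, of "\<psi> C"] \<psi>(3)[OF that] CW[OF that] by blast
      then show ?thesis unfolding K'_def by blast
    qed
  next
    fix F h T and z\<^sub>0 :: complex and e :: real
    assume F: "F holomorphic_on W" "inj_on F W" and h: "h holomorphic_on W"
      and T: "closed T" "connected (-T)" "z\<^sub>0 \<notin> T" and z\<^sub>0: "z\<^sub>0 \<notin> F ` W" and FT: "F ` K' \<inter> T = {}" and e: "e > 0"
    have im: "(\<lambda>u. F (\<psi> C u)) ` ball 0 1 = F ` C" if "C \<in> \<C>" for C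
      using \<psi>(3)[OF that] by (metis image_image)
    have comp: "(\<lambda>u. g (\<psi> C u)) holomorphic_on ball 0 1" if "C \<in> \<C>" "g holomorphic_on W" for C g
      using holomorphic_on_compose_gen[OF \<psi>(1)[OF that(1)] that(2)] \<psi>(3)[OF that(1)] CW[OF that(1)]
      by (simp add: o_def)
    obtain p where p: "\<And>z. z \<in> T \<Longrightarrow> norm (poly p (1 / (z - z\<^sub>0))) < e"
      "\<And>C u. \<lbrakk>C \<in> \<C>; norm u \<le> r\<rbrakk> \<Longrightarrow> dist (poly p (1 / (F (\<psi> C u) - z\<^sub>0))) (h (\<psi> C u)) < e"
    proof (rule simultaneous_Runge[OF C(1) T, of "\<lambda>C u. F (\<psi> C u)" "\<lambda>C u. h (\<psi> C u)" r r' e])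
      fix C assume C': "C \<in> \<C>"
      show "(\<lambda>u. F (\<psi> C u)) holomorphic_on ball 0 1" "(\<lambda>u. h (\<psi> C u)) holomorphic_on ball 0 1"
        using C' F h by (auto intro: comp)
      show "inj_on (\<lambda>u. F (\<psi> C u)) (ball 0 1)"
      proof (rule inj_onI)
        fix u v assume uv: "u \<in> ball 0 1" "v \<in> ball 0 1" and eq: "F (\<psi> C u) = F (\<psi> C v)"
        have "\<psi> C u \<in> W" "\<psi> C v \<in> W" using uv \<psi>(3)[OF C'] CW[OF C'] by blast+
        then have "\<psi> C u = \<psi> C v" using inj_onD[OF F(2) eq] by blast
        then show "u = v" using inj_onD[OF \<psi>(2)[OF C'] _ uv] by blast
      qed
      show "z\<^sub>0 \<notin> (\<lambda>u. F (\<psi> C u)) ` ball 0 1"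
        unfolding im[OF C'] using z\<^sub>0 CW[OF C'] by blast
      show "(\<lambda>u. F (\<psi> C u)) ` cball 0 r' \<inter> T = {}"
      proof -
        have "(\<lambda>u. F (\<psi> C u)) ` cball 0 r' \<subseteq> F ` K'"
          unfolding K'_def using C' by blast
        then show ?thesis using FT by blast
      qed
    next
      show "disjoint_family_on (\<lambda>C. (\<lambda>u. F (\<psi> C u)) ` ball 0 1) \<C>"
        unfolding disjoint_family_on_def
      proof (intro ballI impI)
        fix A B assume AB: "A \<in> \<C>" "B \<in> \<C>" "A \<noteq> B"
        then have "A \<inter> B = {}" using components_nonoverlap[of A W B] C(2) by blast
        then have "F ` A \<inter> F ` B = {}"
          using inj_on_image_Int[OF F(2) CW[OF AB(1)] CW[OF AB(2)]] by simp
        then show "(\<lambda>u. F (\<psi> A u)) ` ball 0 1 \<inter> (\<lambda>u. F (\<psi> B u)) ` ball 0 1 = {}"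
          by (simp only: im AB)
      qed
    qed (use r r' e in auto)
    have "dist (poly p (1 / (F z - z\<^sub>0))) (h z) < e" if z: "z \<in> K" for z
    proof -
      obtain C where "C \<in> \<C>" "z \<in> \<psi> C ` cball 0 r" using cov z by blast
      moreover from this obtain u where "norm u \<le> r" "z = \<psi> C u" by auto
      ultimately have "C \<in> \<C>" "norm u \<le> r" "z = \<psi> C u" by blast+
      then show ?thesis using p(2) by blast
    qed
    then show "\<exists>p. (\<forall>z\<in>T. norm (poly p (1 / (z - z\<^sub>0))) < e) \<and>
        (\<forall>z\<in>K. dist (poly p (1 / (F z - z\<^sub>0))) (h z) < e)"
      using p(1) by blast
  qed
qed

section \<open>Countable families\<close>

lemma countable_dense_polynomials:
  obtains \<P> :: "complex poly set" where "countable \<P>"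
    "\<And>p R e. e > 0 \<Longrightarrow> \<exists>q\<in>\<P>. \<forall>w. norm w \<le> R \<longrightarrow> dist (poly p w) (poly q w) < e"
proof -
  obtain D :: "complex set" where D: "countable D" "\<And>X. open X \<Longrightarrow> X \<noteq> {} \<Longrightarrow> \<exists>d\<in>D. d \<in> X"
    using countable_dense_exists by blast
  have "\<exists>q\<in>Poly ` lists D. \<forall>w. norm w \<le> R \<longrightarrow> dist (poly p w) (poly q w) < e"
    if "e > 0" for p R and e :: real
    using that
  proof (induction p arbitrary: e)
    case 0
    have "Poly [] \<in> Poly ` lists D" by blast
    then show ?case using 0 by (intro bexI[of _ "Poly []"]) auto
  next
    case (pCons a p)
    define e' where "e' = e / (2 * (\<bar>R\<bar> + 1))"
    have e': "e' > 0" using pCons.prems by (simp add: e'_def)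
    obtain xs where xs: "xs \<in> lists D" "\<And>w. norm w \<le> R \<Longrightarrow> dist (poly p w) (poly (Poly xs) w) < e'"
      using pCons.IH[OF e'] by blast
    obtain d where d: "d \<in> D" "dist a d < e/2"
      using D(2)[of "ball a (e/2)"] pCons.prems by auto
    have "dist (poly (pCons a p) w) (poly (Poly (d # xs)) w) < e" if w: "norm w \<le> R" for w
    proof -
      have "poly (pCons a p) w - poly (Poly (d # xs)) w = (a - d) + w * (poly p w - poly (Poly xs) w)"
        by (simp add: algebra_simps)
      then have "dist (poly (pCons a p) w) (poly (Poly (d # xs)) w) \<le>
          dist a d + norm w * dist (poly p w) (poly (Poly xs) w)"
        unfolding dist_norm by (metis norm_mult norm_triangle_ineq)
      also have "\<dots> < e/2 + (\<bar>R\<bar> + 1) * e'"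
        using d(2) xs(2)[OF w] w e' by (intro add_less_le_mono mult_mono) auto
      also have "\<dots> = e" by (simp add: e'_def field_simps)
      finally show ?thesis .
    qed
    moreover have "Poly (d # xs) \<in> Poly ` lists D" using d(1) xs(1) by (intro imageI) simp
    ultimately show ?case by (intro bexI[of _ "Poly (d # xs)"] allI impI)
  qed
  moreover have "countable (Poly ` lists D)" using D(1) by (intro countable_image countable_lists)
  ultimately show ?thesis using that by blast
qed

text \<open>
  Cover \<open>K\<close> by finitely many sets from a countable basis whose closures are compact subsets of \<open>W\<close>, and take
  the union of these closures.
\<close>
lemma countable_compact_exhaustion:
  obtains \<K> :: "complex set set" where "countable \<K>"
    "\<And>K W. \<lbrakk>compact K; K \<subseteq> W; open W\<rbrakk> \<Longrightarrow> \<exists>K'\<in>\<K>. compact K' \<and> K \<subseteq> K' \<and> K' \<subseteq> W"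
proof -
  obtain B :: "complex set set" where B: "countable B" "topological_basis B"
    using ex_countable_basis by blast
  define \<K> where "\<K> = (\<lambda>F. \<Union>X\<in>F. closure X) ` {F. finite F \<and> F \<subseteq> B}"
  have "\<exists>K'\<in>\<K>. compact K' \<and> K \<subseteq> K' \<and> K' \<subseteq> W" if K: "compact K" "K \<subseteq> W" and W: "open W" for K W
  proof -
    define S where "S = {X \<in> B. compact (closure X) \<and> closure X \<subseteq> W}"
    have "K \<subseteq> \<Union>S"
    proof
      fix x assume "x \<in> K"
      then obtain d where d: "d > 0" "cball x d \<subseteq> W"
        using W K(2) open_contains_cball by blast
      obtain X where X: "X \<in> B" "x \<in> X" "X \<subseteq> ball x d"
        using topological_basisE[OF B(2) open_ball[of x d]] d(1) by (metis centre_in_ball)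
      have "X \<subseteq> cball x d" using X(3) ball_subset_cball by blast
      then have c: "closure X \<subseteq> cball x d" by (simp add: closure_minimal)
      then have "compact (closure X)"
        using bounded_subset[OF bounded_cball c] by (simp add: compact_eq_bounded_closed)
      then show "x \<in> \<Union>S" using X c d(2) by (auto simp: S_def)
    qed
    moreover have "open X" if "X \<in> S" for X
      using that B(2) topological_basis_open by (auto simp: S_def)
    ultimately obtain F where F: "F \<subseteq> S" "finite F" "K \<subseteq> \<Union>F"
      using compactE[OF K(1)] by metis
    have "compact (\<Union>X\<in>F. closure X)" "(\<Union>X\<in>F. closure X) \<subseteq> W"
      using F(1,2) by (auto simp: S_def intro!: compact_UN)
    moreover have "K \<subseteq> (\<Union>X\<in>F. closure X)" using F(3) closure_subset by blast
    moreover have "(\<Union>X\<in>F. closure X) \<in> \<K>" using F by (auto simp: \<K>_def S_def)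
    ultimately show ?thesis by blast
  qed
  moreover have "countable \<K>"
    unfolding \<K>_def using countable_Collect_finite_subset[OF B(1)] by (rule countable_image)
  ultimately show ?thesis using that by blast
qed

section \<open>Density and Baire category in spaces of holomorphic functions\<close>

lemma dense_in_hol_topology_iff:
  assumes S: "S \<subseteq> hol_space W"
  shows "dense_in (hol_topology W) S \<longleftrightarrow>
    (\<forall>g\<in>hol_space W. \<forall>K e. compact K \<and> K \<subseteq> W \<and> e > 0 \<longrightarrow> (\<exists>h\<in>S. \<forall>z\<in>K. dist (h z) (g z) < e))"
    (is "?dense \<longleftrightarrow> ?approx")
proof
  assume d: ?dense
  show ?approx
  proof (intro ballI allI impI)
    fix g K and e :: real
    assume g: "g \<in> hol_space W" and K: "compact K \<and> K \<subseteq> W \<and> e > 0"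
    define N where "N = {h \<in> hol_space W. \<forall>z\<in>K. dist (h z) (g z) < e}"
    have "g \<in> hol_topology W closure_of S"
      using d g unfolding dense_in_def by simp
    moreover have "openin (hol_topology W) N"
      unfolding N_def using K g by (intro openin_hol_nbhd) auto
    moreover have "g \<in> N" using K g by (simp add: N_def)
    ultimately obtain h where "h \<in> S" "h \<in> N"
      unfolding in_closure_of by blast
    then show "\<exists>h\<in>S. \<forall>z\<in>K. dist (h z) (g z) < e"
      by (auto simp: N_def)
  qed
next
  assume a: ?approx
  have "g \<in> hol_topology W closure_of S" if g: "g \<in> hol_space W" for g
    unfolding in_closure_of
  proof (intro conjI allI impI)
    fix N assume "g \<in> N \<and> openin (hol_topology W) N"
    then have "\<exists>K e. compact K \<and> K \<subseteq> W \<and> e > 0 \<and>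
        {h \<in> hol_space W. \<forall>z\<in>K. dist (h z) (g z) < e} \<subseteq> N"
      unfolding openin_hol_topology by (elim conjE) (erule bspec)
    then obtain K e where K: "compact K" "K \<subseteq> W" "e > 0"
        "{h \<in> hol_space W. \<forall>z\<in>K. dist (h z) (g z) < e} \<subseteq> N"
      by (elim exE conjE) (rule that)
    obtain h where "h \<in> S" "\<forall>z\<in>K. dist (h z) (g z) < e"
      using a[rule_format, OF g, of K e] K by auto
    then show "\<exists>y. y \<in> S \<and> y \<in> N"
      using K(4) S by blast
  qed (use g in simp)
  then have "hol_topology W closure_of S = hol_space W"
    using closure_of_subset_topspace[of "hol_topology W" S] by auto
  then show ?dense
    unfolding dense_in_def using S by simp
qed

text \<open>
  The standard proof for complete metric spaces, carried out with the basic neighbourhoods themselves.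
  Nested neighbourhoods \<open>N (K n) (e n) (g n)\<close> are chosen such that \<open>e n\<close> tends to \<open>0\<close> and the sets
  \<open>K n\<close> absorb an exhaustion of \<open>W\<close> by compact sets. Then the centres \<open>g n\<close> converge uniformly on compact subsets
  of \<open>W\<close>, and by Weierstrass's theorem the limit is holomorphic. It lies in all the neighbourhoods because these are
  defined by non-strict inequalities.
\<close>
lemma hol_space_Baire:
  assumes W: "open W"
    and opn: "\<And>n::nat. openin (hol_topology W) (G n)"
    and dns: "\<And>n. dense_in (hol_topology W) (G n)"
  shows "dense_in (hol_topology W) (\<Inter>n. G n)"
proof -
  obtain C where C: "\<And>n. compact (C n)" "\<And>n. C n \<subseteq> W"
      "\<And>n. C n \<subseteq> interior (C (Suc n))"
      "\<And>K. \<lbrakk>compact K; K \<subseteq> W\<rbrakk> \<Longrightarrow> \<exists>N::nat. \<forall>n\<ge>N. K \<subseteq> C n"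
    by (rule open_Union_compact_subsets[OF W]) (rule that)
  have Gsub: "G n \<subseteq> hol_space W" for n
    using openin_subset[OF opn] by simp
  have Csub: "C m \<subseteq> C n" if "m \<le> n" for m n
    using that
  proof (induction n rule: dec_induct)
    case (step n)
    then show ?case using C(3)[of n] interior_subset[of "C (Suc n)"] by blast
  qed simp
  define N where "N K e g = {h \<in> hol_space W. \<forall>z\<in>K. dist (h z) (g z) \<le> e}"
    for K and e :: real and g :: "complex \<Rightarrow> complex"
  show ?thesis
  proof (subst dense_in_hol_topology_iff, use Gsub in blast, intro ballI allI impI)
    fix g0 K0 and e0 :: real
    assume g0: "g0 \<in> hol_space W" and K0: "compact K0 \<and> K0 \<subseteq> W \<and> e0 > 0"
    \<comment> \<open>A state \<open>(K, e, g)\<close> stands for the neighbourhood \<open>N K e g\<close>, and \<open>R n x y\<close> says that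
        \<open>y\<close> may follow \<open>x\<close> in step \<open>n\<close>, where the open set \<open>G n\<close> is entered.\<close>
    define good where
      "good x \<longleftrightarrow> (case x of (K, e, g) \<Rightarrow> compact K \<and> K \<subseteq> W \<and> 0 < e \<and> g \<in> hol_space W)"
      for x :: "complex set \<times> real \<times> (complex \<Rightarrow> complex)"
    define R where
      "R n x y \<longleftrightarrow> (case (x, y) of ((K, e, g), (K', e', g')) \<Rightarrow>
         K \<union> C n \<subseteq> K' \<and> e' \<le> (1/2)^n \<and> N K' e' g' \<subseteq> N K e g \<inter> G n)"
      for n and x y :: "complex set \<times> real \<times> (complex \<Rightarrow> complex)"
    have step: "\<exists>y. good y \<and> R n x y" if x: "good x" for x n
    proof -
      obtain K e g where xe: "x = (K, e, g)" by (cases x)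
      with x have K: "compact K" "K \<subseteq> W" "0 < e" "g \<in> hol_space W"
        by (auto simp: good_def)
      obtain h where h: "h \<in> G n" "\<forall>z\<in>K. dist (h z) (g z) < e/2"
        using dns[of n, unfolded dense_in_hol_topology_iff[OF Gsub], rule_format, OF K(4), of K "e/2"] K
        by auto
      have "\<exists>L d. compact L \<and> L \<subseteq> W \<and> d > 0 \<and>
          {k \<in> hol_space W. \<forall>z\<in>L. dist (k z) (h z) < d} \<subseteq> G n"
        using opn[of n] h(1) unfolding openin_hol_topology by (elim conjE) (erule bspec)
      then obtain L d where L: "compact L" "L \<subseteq> W" "d > 0"
          "{k \<in> hol_space W. \<forall>z\<in>L. dist (k z) (h z) < d} \<subseteq> G n"
        by (elim exE conjE) (rule that)
      define e' where "e' = Min {e/2, d/2, (1/2)^n}"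
      have e': "0 < e'" "e' \<le> e/2" "e' \<le> d/2" "e' \<le> (1/2)^n"
        using K(3) L(3) unfolding e'_def by auto
      have "N (K \<union> L \<union> C n) e' h \<subseteq> N K e g \<inter> G n"
      proof
        fix k assume "k \<in> N (K \<union> L \<union> C n) e' h"
        then have k: "k \<in> hol_space W" "\<And>z. z \<in> K \<union> L \<union> C n \<Longrightarrow> dist (k z) (h z) \<le> e'"
          unfolding N_def by auto
        have "dist (k z) (g z) \<le> e" if "z \<in> K" for z
          using k(2)[of z] h(2) that e' dist_triangle[of "k z" "g z" "h z"] by fastforce
        moreover have "dist (k z) (h z) < d" if "z \<in> L" for z
          using k(2)[of z] that e' L(3) by fastforce
        ultimately have "k \<in> N K e g" "k \<in> {k \<in> hol_space W. \<forall>z\<in>L. dist (k z) (h z) < d}"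
          using k(1) unfolding N_def by auto
        then show "k \<in> N K e g \<inter> G n"
          using L(4) by blast
      qed
      moreover have "h \<in> hol_space W" using h(1) Gsub by blast
      ultimately have "good (K \<union> L \<union> C n, e', h) \<and> R n x (K \<union> L \<union> C n, e', h)"
        using K L C e' by (auto simp: good_def R_def xe)
      then show ?thesis by blast
    qed
    have g0good: "good (K0, e0/2, g0)"
      using K0 g0 by (simp add: good_def)
    \<comment> \<open>Starting with radius \<open>e0/2\<close> turns the non-strict inequality for the limit into the strict one required.\<close>
    define X where "X = rec_nat (K0, e0/2, g0) (\<lambda>n x. SOME y. good y \<and> R n x y)"
    have X0: "X 0 = (K0, e0/2, g0)" by (simp add: X_def)
    have XS: "X (Suc n) = (SOME y. good y \<and> R n (X n) y)" for n by (simp add: X_def)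
    have Xg: "good (X n)" for n
    proof (induction n)
      case (Suc n)
      show ?case using someI_ex[OF step[OF Suc]] unfolding XS by (rule conjunct1)
    qed (simp add: X0 g0good)
    have XR: "R n (X n) (X (Suc n))" for n
      unfolding XS using someI_ex[OF step[OF Xg]] by (rule conjunct2)
    define K e g where "K n = fst (X n)" and "e n = fst (snd (X n))" and "g n = snd (snd (X n))" for n
    have Xn: "X n = (K n, e n, g n)" for n by (simp add: K_def e_def g_def)
    have P: "compact (K n)" "K n \<subseteq> W" "0 < e n" "g n \<in> hol_space W" for n
      using Xg[of n] by (auto simp: good_def Xn)
    have Q: "K n \<subseteq> K (Suc n)" "C n \<subseteq> K (Suc n)" "e (Suc n) \<le> (1/2)^n"
        "N (K (Suc n)) (e (Suc n)) (g (Suc n)) \<subseteq> N (K n) (e n) (g n)"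
        "N (K (Suc n)) (e (Suc n)) (g (Suc n)) \<subseteq> G n" for n
      using XR[of n] by (auto simp: R_def Xn)
    have Nmono: "N (K n) (e n) (g n) \<subseteq> N (K m) (e m) (g m)" if "m \<le> n" for m n
      using that
    proof (induction n rule: dec_induct)
      case (step n)
      show ?case by (rule subset_trans[OF Q(4) step(3)])
    qed simp
    have gN: "g n \<in> N (K m) (e m) (g m)" if "m \<le> n" for m n
    proof -
      have "g n \<in> N (K n) (e n) (g n)"
        using P(3,4)[of n] unfolding N_def by simp
      then show ?thesis using Nmono[OF that] by blast
    qed
    have Cauchy: "dist (g n z) (g m z) \<le> e m" if "m \<le> n" "z \<in> K m" for m n z
      using gN[OF that(1)] that(2) unfolding N_def by simp
    have CK: "C m \<subseteq> K n" if "m < n" for m n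
    proof -
      obtain k where "n = Suc k" "m \<le> k" using \<open>m < n\<close> by (cases n) auto
      then show ?thesis using Csub[of m k] Q(2)[of k] by blast
    qed
    have ucauchy: "uniformly_convergent_on L g" if L: "compact L" "L \<subseteq> W" for L
      unfolding uniformly_convergent_eq_Cauchy uniformly_Cauchy_on_def
    proof (intro allI impI)
      fix d :: real assume "d > 0"
      then obtain j where j: "(1/2)^j < d/2"
        using real_arch_pow_inv[of "d/2" "1/2"] by auto
      obtain i where i: "\<forall>n\<ge>i. L \<subseteq> C n" using C(4)[OF L] by blast
      define M where "M = Suc (max i j)"
      have "L \<subseteq> C (max i j)" using i by simp
      then have "L \<subseteq> K M" using CK[of "max i j" M] unfolding M_def by blast
      moreover have eM: "e M < d/2"
      proof -
        have "e M \<le> (1/2)^(max i j)" using Q(3) unfolding M_def by blast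
        also have "\<dots> \<le> (1/2)^j" by (rule power_decreasing) auto
        finally show ?thesis using j by linarith
      qed
      ultimately have "dist (g m z) (g n z) < d" if mn: "m \<ge> M" "n \<ge> M" "z \<in> L" for m n z
      proof -
        have "z \<in> K M" using \<open>L \<subseteq> K M\<close> mn(3) by blast
        then show ?thesis
          using Cauchy[OF mn(1)] Cauchy[OF mn(2)] eM dist_triangle2[of "g m z" "g n z" "g M z"]
          by fastforce
      qed
      then show "\<exists>M. \<forall>x\<in>L. \<forall>m\<ge>M. \<forall>n\<ge>M. dist (g m x) (g n x) < d"
        by blast
    qed
    define G0 where "G0 = restrict (\<lambda>z. lim (\<lambda>n. g n z)) W"
    have ulim: "uniform_limit L g G0 sequentially" if L: "compact L" "L \<subseteq> W" for L
    proof -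
      have "uniform_limit L g (\<lambda>z. lim (\<lambda>n. g n z)) sequentially"
        using ucauchy[OF L] uniformly_convergent_uniform_limit_iff by blast
      then show ?thesis
        using uniform_limit_cong'[of L g g "\<lambda>z. lim (\<lambda>n. g n z)" G0 sequentially] L(2)
        by (auto simp: G0_def subset_iff)
    qed
    have "G0 holomorphic_on W"
    proof (rule holomorphic_uniform_sequence[OF W, of g])
      show "g n holomorphic_on W" for n using P(4) by (simp add: hol_space_def)
      fix x assume "x \<in> W"
      then obtain d where "d > 0" "cball x d \<subseteq> W"
        using W open_contains_cball by blast
      then show "\<exists>d>0. cball x d \<subseteq> W \<and> uniform_limit (cball x d) g G0 sequentially"
        using ulim[of "cball x d"] by auto
    qed
    then have G0H: "G0 \<in> hol_space W" by (simp add: hol_space_def G0_def)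
    have G0N: "G0 \<in> N (K m) (e m) (g m)" for m
    proof -
      have "dist (G0 z) (g m z) \<le> e m" if z: "z \<in> K m" for z
      proof (rule tendsto_upperbound[of _ _ sequentially])
        show "(\<lambda>n. dist (g n z) (g m z)) \<longlonglongrightarrow> dist (G0 z) (g m z)"
        proof (intro tendsto_dist tendsto_const)
          have "uniform_limit {z} g G0 sequentially" using z P(2)[of m] by (intro ulim) auto
          then show "(\<lambda>n. g n z) \<longlonglongrightarrow> G0 z" by (rule tendsto_uniform_limitI) simp
        qed
        show "\<forall>\<^sub>F n in sequentially. dist (g n z) (g m z) \<le> e m"
          using eventually_ge_at_top[of m] by (rule eventually_mono) (rule Cauchy[OF _ z])
      qed simp
      then show ?thesis using G0H unfolding N_def by simp
    qed
    have "G0 \<in> (\<Inter>n. G n)" using G0N Q(5) by blast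
    moreover have "\<forall>z\<in>K0. dist (G0 z) (g0 z) < e0"
    proof
      fix z assume "z \<in> K0"
      then have "dist (G0 z) (g0 z) \<le> e0/2"
        using G0N[of 0] X0 by (auto simp: N_def Xn)
      then show "dist (G0 z) (g0 z) < e0" using K0 by simp
    qed
    ultimately show "\<exists>h\<in>\<Inter> (range G). \<forall>z\<in>K0. dist (h z) (g0 z) < e0"
      by blast
  qed
qed

lemma comeager_in_countable_Inter:
  assumes W: "open W" and "countable \<G>" "\<G> \<noteq> {}"
    and "\<And>G. G \<in> \<G> \<Longrightarrow> openin (hol_topology W) G \<and> dense_in (hol_topology W) G"
    and "\<Inter>\<G> \<subseteq> S" "S \<subseteq> hol_space W"
  shows "comeager_in (hol_topology W) S"
proof -
  have G: "(\<Inter>n. from_nat_into \<G> n) = \<Inter>\<G>"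
    using assms(2,3) by simp
  have "dense_in (hol_topology W) (\<Inter>n. from_nat_into \<G> n)"
    using assms(4)[OF from_nat_into[OF assms(3)]] by (intro hol_space_Baire W) blast+
  moreover have "gdelta_in (hol_topology W) (\<Inter>\<G>)"
    using assms by (intro gdelta_in_Inter) (auto intro: open_imp_gdelta_in)
  ultimately show ?thesis
    unfolding comeager_in_def using G assms by auto
qed

section \<open>Iterates in a linearizing coordinate\<close>

locale Koenigs_linearization =
  fixes z\<^sub>0 lam :: complex and f \<phi> :: "complex \<Rightarrow> complex" and U :: "complex set"
  assumes open_U: "open U" and z\<^sub>0_in: "z\<^sub>0 \<in> U"
    and f_hol: "f holomorphic_on U" and f_self: "f ` U \<subseteq> U" and f_fix: "f z\<^sub>0 = z\<^sub>0"
    and lam: "0 < cmod lam" "cmod lam < 1"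
    and \<phi>_hol: "\<phi> holomorphic_on U" and \<phi>_inj: "inj_on \<phi> U"
    and linear: "\<And>z. z \<in> U \<Longrightarrow> \<phi> (f z) = lam * \<phi> z"
begin

lemma iterate_in: "z \<in> U \<Longrightarrow> (f ^^ n) z \<in> U"
  using f_self by (induction n) auto

lemma iterate_holomorphic: "(f ^^ n) holomorphic_on U"
proof (induction n)
  case (Suc n)
  have "f \<circ> (f ^^ n) holomorphic_on U"
    using iterate_in by (intro holomorphic_on_compose_gen[OF Suc f_hol]) auto
  then show ?case by (simp only: funpow.simps)
qed (simp add: id_def)

lemma iterate_linear: "z \<in> U \<Longrightarrow> \<phi> ((f ^^ n) z) = lam ^ n * \<phi> z"
  using linear iterate_in by (induction n) auto

lemma iterate_inj: "inj_on (f ^^ n) U"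
proof (rule inj_onI)
  fix x y assume xy: "x \<in> U" "y \<in> U" "(f ^^ n) x = (f ^^ n) y"
  then have "lam ^ n * \<phi> x = lam ^ n * \<phi> y" using iterate_linear by metis
  then have "\<phi> x = \<phi> y" using lam by auto
  then show "x = y" using inj_onD[OF \<phi>_inj] xy by blast
qed

lemma iterate_punctured: "z \<in> U - {z\<^sub>0} \<Longrightarrow> (f ^^ n) z \<in> U - {z\<^sub>0}"
proof -
  assume z: "z \<in> U - {z\<^sub>0}"
  have "(f ^^ n) z\<^sub>0 = z\<^sub>0" using f_fix by (induction n) auto
  then have "(f ^^ n) z \<noteq> z\<^sub>0" using inj_onD[OF iterate_inj[of n], of z z\<^sub>0] z z\<^sub>0_in by auto
  then show ?thesis using iterate_in z by blast
qed

lemma \<phi>_fixpoint: "\<phi> z\<^sub>0 = 0"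
proof -
  have "(1 - lam) * \<phi> z\<^sub>0 = 0" using linear[OF z\<^sub>0_in] f_fix by (simp add: algebra_simps)
  moreover have "lam \<noteq> 1" using lam by auto
  ultimately show ?thesis by simp
qed

text \<open>
  The set \<open>\<phi> ` (ball z\<^sub>0 d \<inter> U)\<close> is an open neighbourhood of \<open>0 = \<phi> z\<^sub>0\<close>, so it contains \<open>lam ^ n * \<phi> z\<close> for all
  \<open>z\<close> in \<open>K\<close> when \<open>n\<close> is large. Injectivity of \<open>\<phi>\<close> brings this back to \<open>(f ^^ n) z\<close>.
\<close>
lemma iterates_shrink:
  assumes K: "compact K" "K \<subseteq> U" and d: "d > 0"
  obtains n where "n \<ge> 1" "(f ^^ n) ` K \<subseteq> ball z\<^sub>0 d"
proof -
  have sub: "ball z\<^sub>0 d \<inter> U \<subseteq> U" by blast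
  have "open (\<phi> ` (ball z\<^sub>0 d \<inter> U))"
    by (rule open_mapping_thm3[OF holomorphic_on_subset[OF \<phi>_hol sub] _ inj_on_subset[OF \<phi>_inj sub]])
      (use open_U in blast)
  moreover have "0 \<in> \<phi> ` (ball z\<^sub>0 d \<inter> U)"
    using \<phi>_fixpoint z\<^sub>0_in d by (intro image_eqI[of _ _ z\<^sub>0]) auto
  ultimately obtain s where s: "s > 0" "ball 0 s \<subseteq> \<phi> ` (ball z\<^sub>0 d \<inter> U)"
    using open_contains_ball by blast
  have "compact (\<phi> ` K)"
    using continuous_on_subset[OF holomorphic_on_imp_continuous_on[OF \<phi>_hol] K(2)] K(1)
    by (rule compact_continuous_image)
  then obtain B where B: "B > 0" "\<forall>x\<in>\<phi> ` K. norm x \<le> B"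
    using compact_imp_bounded bounded_pos by metis
  obtain m where m: "cmod lam ^ m < s / B"
    using real_arch_pow_inv[of "s / B" "cmod lam"] s(1) B(1) lam(2) by auto
  have "cmod lam ^ Suc m \<le> cmod lam ^ m" using lam by (intro power_decreasing) auto
  then have "cmod lam ^ Suc m < s / B" using m by (rule le_less_trans)
  then have m': "cmod lam ^ Suc m * B < s" using B(1) by (simp only: pos_less_divide_eq)
  have "(f ^^ Suc m) z \<in> ball z\<^sub>0 d" if z: "z \<in> K" for z
  proof -
    have zU: "z \<in> U" using z K by blast
    have "norm (lam ^ Suc m * \<phi> z) \<le> cmod lam ^ Suc m * B"
      using B z unfolding norm_mult norm_power by (intro mult_left_mono) auto
    then have "\<phi> ((f ^^ Suc m) z) \<in> ball 0 s"
      using m' unfolding iterate_linear[OF zU] by simp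
    then obtain w where w: "w \<in> ball z\<^sub>0 d \<inter> U" "\<phi> ((f ^^ Suc m) z) = \<phi> w"
      using s(2) by blast
    then have "(f ^^ Suc m) z = w"
      using inj_onD[OF \<phi>_inj w(2)] iterate_in[OF zU] by blast
    then show ?thesis using w by blast
  qed
  then have "(f ^^ Suc m) ` K \<subseteq> ball z\<^sub>0 d" by (rule image_subsetI)
  then show ?thesis by (rule that[rotated]) simp
qed

section \<open>Universal functions\<close>

definition hits :: "complex set \<Rightarrow> complex poly \<Rightarrow> real \<Rightarrow> (complex \<Rightarrow> complex) set" where
  "hits K p e = {g \<in> hol_space (UNIV - {z\<^sub>0}).
     \<exists>n\<ge>1. \<forall>z\<in>K. dist (g ((f ^^ n) z)) (poly p (1 / (z - z\<^sub>0))) < e}"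

lemma hits_subset: "hits K p e \<subseteq> hol_space (UNIV - {z\<^sub>0})"
  by (auto simp: hits_def)

text \<open>
  For fixed \<open>n\<close> the condition concerns the values of \<open>g\<close> on the compact set \<open>(f ^^ n) ` K\<close>, and the continuous function
  \<open>z \<mapsto> dist (g ((f ^^ n) z)) (poly p (1 / (z - z\<^sub>0)))\<close> attains its maximum on \<open>K\<close>, which leaves room for a small
  perturbation of \<open>g\<close>.
\<close>
lemma openin_hits:
  assumes K: "compact K" "K \<subseteq> U - {z\<^sub>0}"
  shows "openin (hol_topology (UNIV - {z\<^sub>0})) (hits K p e)"
  unfolding openin_hol_topology
proof (intro conjI ballI hits_subset)
  fix g assume "g \<in> hits K p e"
  then obtain n where g: "g \<in> hol_space (UNIV - {z\<^sub>0})" and n: "n \<ge> 1"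
    and lt: "\<And>z. z \<in> K \<Longrightarrow> dist (g ((f ^^ n) z)) (poly p (1 / (z - z\<^sub>0))) < e"
    by (auto simp: hits_def)
  let ?L = "(f ^^ n) ` K"
  have cf: "continuous_on K (f ^^ n)"
    using holomorphic_on_imp_continuous_on[OF iterate_holomorphic] K(2) continuous_on_subset by blast
  have L: "compact ?L" "?L \<subseteq> UNIV - {z\<^sub>0}"
    using compact_continuous_image[OF cf K(1)] iterate_punctured K(2) by auto
  have "continuous_on ?L g"
    using g L(2) unfolding hol_space_def
    by (auto intro: holomorphic_on_imp_continuous_on continuous_on_subset)
  then have cont: "continuous_on K (\<lambda>z. dist (g ((f ^^ n) z)) (poly p (1 / (z - z\<^sub>0))))"
    using K(2) by (intro continuous_intros continuous_on_compose2[OF _ cf]) auto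
  obtain d where d: "d > 0" "\<And>z. z \<in> K \<Longrightarrow> dist (g ((f ^^ n) z)) (poly p (1 / (z - z\<^sub>0))) + d \<le> e"
  proof (cases "K = {}")
    case True
    then show ?thesis using that[of 1] by simp
  next
    case False
    then obtain x where x: "x \<in> K" "\<forall>z\<in>K. dist (g ((f ^^ n) z)) (poly p (1 / (z - z\<^sub>0)))
        \<le> dist (g ((f ^^ n) x)) (poly p (1 / (x - z\<^sub>0)))"
      using continuous_attains_sup[OF K(1) _ cont] by auto
    show ?thesis
      by (rule that[of "e - dist (g ((f ^^ n) x)) (poly p (1 / (x - z\<^sub>0)))"]) (use x lt in auto)
  qed
  have "{h \<in> hol_space (UNIV - {z\<^sub>0}). \<forall>w\<in>?L. dist (h w) (g w) < d} \<subseteq> hits K p e"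
  proof
    fix h assume h: "h \<in> {h \<in> hol_space (UNIV - {z\<^sub>0}). \<forall>w\<in>?L. dist (h w) (g w) < d}"
    have "dist (h ((f ^^ n) z)) (poly p (1 / (z - z\<^sub>0))) < e" if z: "z \<in> K" for z
    proof -
      have "dist (h ((f ^^ n) z)) (g ((f ^^ n) z)) < d" using h z by simp
      then show ?thesis
        using d(2)[OF z] dist_triangle[of "h ((f ^^ n) z)" "poly p (1 / (z - z\<^sub>0))" "g ((f ^^ n) z)"]
        by linarith
    qed
    then show "h \<in> hits K p e" using h n by (auto simp: hits_def)
  qed
  then show "\<exists>L d. compact L \<and> L \<subseteq> UNIV - {z\<^sub>0} \<and> d > 0 \<and>
      {h \<in> hol_space (UNIV - {z\<^sub>0}). \<forall>w\<in>L. dist (h w) (g w) < d} \<subseteq> hits K p e"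
    using L d(1) by (intro exI[of _ ?L] exI[of _ d] conjI)
qed

text \<open>
  Given \<open>g\<close> and a compact set \<open>L\<close> avoiding a disc around \<open>z\<^sub>0\<close>, choose \<open>n\<close> such that \<open>f ^^ n\<close> maps the set \<open>K'\<close> of
  \<open>no_holes_Runge\<close> into this disc. Runge's theorem, with \<open>T\<close> the complement of the disc, gives a correction \<open>q\<close>
  that is small on \<open>L\<close> and close to the error \<open>poly p (1 / (z - z\<^sub>0)) - g ((f ^^ n) z)\<close> at the points \<open>(f ^^ n) z\<close>.
\<close>
lemma dense_in_hits:
  assumes W: "W \<in> open_without_holes (U - {z\<^sub>0})" and K: "compact K" "K \<subseteq> W" and e: "e > 0"
  shows "dense_in (hol_topology (UNIV - {z\<^sub>0})) (hits K p e)"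
proof (subst dense_in_hol_topology_iff[OF hits_subset], intro ballI allI impI)
  fix g L and d :: real
  assume g: "g \<in> hol_space (UNIV - {z\<^sub>0})" and Ld: "compact L \<and> L \<subseteq> UNIV - {z\<^sub>0} \<and> d > 0"
  have W': "open W" "holes W = {}" "W \<subseteq> U - {z\<^sub>0}" "W \<noteq> UNIV"
    using W by (auto simp: open_without_holes_def)
  obtain K' where K': "compact K'" "K' \<subseteq> W" and Runge:
    "\<And>F h T z\<^sub>0 e. \<lbrakk>F holomorphic_on W; inj_on F W; h holomorphic_on W; closed T; connected (-T);
        z\<^sub>0 \<notin> T; z\<^sub>0 \<notin> F ` W; F ` K' \<inter> T = {}; e > 0\<rbrakk> \<Longrightarrow>
      \<exists>p. (\<forall>z\<in>T. norm (poly p (1 / (z - z\<^sub>0))) < e) \<and>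
          (\<forall>z\<in>K. dist (poly p (1 / (F z - z\<^sub>0))) (h z) < e)"
    by (rule no_holes_Runge[OF W'(1,2,4) K]) (rule that)
  have "closed L" "z\<^sub>0 \<notin> L" using Ld by (auto intro: compact_imp_closed)
  then obtain s where s: "s > 0" "\<forall>z\<in>L. s \<le> dist z\<^sub>0 z"
    using separate_point_closed[of L z\<^sub>0] by auto
  have "K' \<subseteq> U" using K'(2) W'(3) by blast
  then obtain n where n: "n \<ge> 1" "(f ^^ n) ` K' \<subseteq> ball z\<^sub>0 s"
    using iterates_shrink[OF K'(1) _ s(1)] by blast
  have WU: "W \<subseteq> U" using W'(3) by blast
  have fW: "(f ^^ n) holomorphic_on W" "inj_on (f ^^ n) W"
    using holomorphic_on_subset[OF iterate_holomorphic WU] inj_on_subset[OF iterate_inj WU] by auto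
  have fz: "(f ^^ n) ` W \<subseteq> UNIV - {z\<^sub>0}" using iterate_punctured W'(3) by blast
  have g_hol: "g holomorphic_on UNIV - {z\<^sub>0}" using g by (simp add: hol_space_def)
  let ?h = "\<lambda>z. poly p (1 / (z - z\<^sub>0)) - g ((f ^^ n) z)"
  have "(g \<circ> (f ^^ n)) holomorphic_on W"
    using fz by (intro holomorphic_on_compose_gen[OF fW(1) g_hol]) auto
  moreover have "(\<lambda>z. poly p (1 / (z - z\<^sub>0))) holomorphic_on W"
    using W'(3) by (intro holomorphic_intros) auto
  ultimately have h: "?h holomorphic_on W"
    unfolding o_def by (intro holomorphic_on_diff)
  have "\<exists>q. (\<forall>z\<in>- ball z\<^sub>0 s. norm (poly q (1 / (z - z\<^sub>0))) < min d e) \<and>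
      (\<forall>z\<in>K. dist (poly q (1 / ((f ^^ n) z - z\<^sub>0))) (?h z) < min d e)"
    by (rule Runge[OF fW h]) (use n(2) s(1) fz e Ld in auto)
  then obtain q where q: "\<And>z. z \<in> - ball z\<^sub>0 s \<Longrightarrow> norm (poly q (1 / (z - z\<^sub>0))) < min d e"
      "\<And>z. z \<in> K \<Longrightarrow> dist (poly q (1 / ((f ^^ n) z - z\<^sub>0))) (?h z) < min d e"
    by blast
  define k where "k = restrict (\<lambda>z. g z + poly q (1 / (z - z\<^sub>0))) (UNIV - {z\<^sub>0})"
  have kz: "k z = g z + poly q (1 / (z - z\<^sub>0))" if "z \<noteq> z\<^sub>0" for z
    using that by (simp add: k_def)
  have "(\<lambda>z. g z + poly q (1 / (z - z\<^sub>0))) holomorphic_on UNIV - {z\<^sub>0}"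
    by (intro holomorphic_intros g_hol) auto
  then have "k holomorphic_on UNIV - {z\<^sub>0}"
    by (rule holomorphic_transform) (simp add: kz)
  then have kH: "k \<in> hol_space (UNIV - {z\<^sub>0})"
    by (simp add: hol_space_def k_def)
  have "dist (k ((f ^^ n) z)) (poly p (1 / (z - z\<^sub>0))) < e" if z: "z \<in> K" for z
  proof -
    have "(f ^^ n) z \<noteq> z\<^sub>0" using fz z K(2) by blast
    then have eq: "k ((f ^^ n) z) - poly p (1 / (z - z\<^sub>0)) = poly q (1 / ((f ^^ n) z - z\<^sub>0)) - ?h z"
      by (simp add: kz)
    show ?thesis using q(2)[OF z] by (simp only: dist_norm eq min_less_iff_conj)
  qed
  then have "k \<in> hits K p e" using kH n(1) by (auto simp: hits_def)
  moreover have "\<forall>z\<in>L. dist (k z) (g z) < d"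
  proof
    fix z assume z: "z \<in> L"
    then have "z \<in> - ball z\<^sub>0 s" using s(2) by auto
    moreover have "z \<noteq> z\<^sub>0" using z Ld by blast
    ultimately show "dist (k z) (g z) < d" using q(1)[of z] by (simp add: kz dist_norm)
  qed
  ultimately show "\<exists>h\<in>hits K p e. \<forall>z\<in>L. dist (h z) (g z) < d"
    by (intro bexI[of _ k])
qed

text \<open>
  A function \<open>h\<close> in \<open>H(W)\<close> is approximated on a compact set by a polynomial \<open>p\<close> in \<open>1 / (z - z\<^sub>0)\<close>, this one by a
  polynomial \<open>q\<close> from the dense family, and the latter by some \<open>g \<circ> f ^^ n\<close> because \<open>g\<close> belongs to the set \<open>hits\<close>
  for \<open>q\<close>.
\<close>
lemma universal_if_hits:
  assumes W: "W \<in> open_without_holes (U - {z\<^sub>0})"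
    and g: "g \<in> hol_space (UNIV - {z\<^sub>0})"
    and \<K>: "\<And>K. \<lbrakk>compact K; K \<subseteq> W\<rbrakk> \<Longrightarrow> \<exists>K'\<in>\<K>. compact K' \<and> K \<subseteq> K' \<and> K' \<subseteq> W"
    and \<P>: "\<And>p R e. e > 0 \<Longrightarrow> \<exists>q\<in>\<P>. \<forall>w. norm w \<le> R \<longrightarrow> dist (poly p w) (poly q w) < e"
    and hits: "\<And>K p m. \<lbrakk>K \<in> \<K>; compact K; K \<subseteq> W; p \<in> \<P>\<rbrakk> \<Longrightarrow> g \<in> hits K p (1 / real (Suc m))"
  shows "universal_for z\<^sub>0 f W g"
proof -
  have W': "open W" "holes W = {}" "W \<subseteq> U - {z\<^sub>0}" "W \<noteq> UNIV"
    using W by (auto simp: open_without_holes_def)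
  have z\<^sub>0W: "z\<^sub>0 \<notin> W" using W'(3) by blast
  have g_hol: "g holomorphic_on UNIV - {z\<^sub>0}" using g by (simp add: hol_space_def)
  let ?S = "{restrict (g \<circ> (f ^^ n)) W | n::nat. n \<ge> 1}"
  have S: "?S \<subseteq> hol_space W"
  proof
    fix k assume "k \<in> ?S"
    then obtain n where k: "k = restrict (g \<circ> (f ^^ n)) W" by blast
    have "W \<subseteq> U" using W'(3) by blast
    then have "(f ^^ n) holomorphic_on W" by (rule holomorphic_on_subset[OF iterate_holomorphic])
    then have "(g \<circ> (f ^^ n)) holomorphic_on W"
      using iterate_punctured W'(3) by (intro holomorphic_on_compose_gen[OF _ g_hol]) blast+
    then have "k holomorphic_on W" by (rule holomorphic_transform) (simp add: k)
    then show "k \<in> hol_space W" by (simp add: hol_space_def k)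
  qed
  have "dense_in (hol_topology W) ?S"
  proof (subst dense_in_hol_topology_iff[OF S], intro ballI allI impI)
    fix h K and e :: real
    assume h: "h \<in> hol_space W" and Ke: "compact K \<and> K \<subseteq> W \<and> e > 0"
    obtain K1 where K1: "K1 \<in> \<K>" "compact K1" "K \<subseteq> K1" "K1 \<subseteq> W"
      using \<K>[of K] Ke by blast
    have e3: "e/3 > 0" using Ke by simp
    obtain p where p: "\<And>z. z \<in> K1 \<Longrightarrow> dist (poly p (1 / (z - z\<^sub>0))) (h z) < e/3"
    proof (rule no_holes_Runge[OF W'(1,2,4) K1(2,4)])
      fix K'
      assume Runge: "\<And>F h T z\<^sub>0 e. \<lbrakk>F holomorphic_on W; inj_on F W; h holomorphic_on W; closed T; connected (-T);
          z\<^sub>0 \<notin> T; z\<^sub>0 \<notin> F ` W; F ` K' \<inter> T = {}; e > 0\<rbrakk> \<Longrightarrow>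
        \<exists>p. (\<forall>z\<in>T. norm (poly p (1 / (z - z\<^sub>0))) < e) \<and>
            (\<forall>z\<in>K1. dist (poly p (1 / (F z - z\<^sub>0))) (h z) < e)"
      have "\<exists>p. (\<forall>z\<in>{}. norm (poly p (1 / (z - z\<^sub>0))) < e/3) \<and>
            (\<forall>z\<in>K1. dist (poly p (1 / (z - z\<^sub>0))) (h z) < e/3)"
        \<comment> \<open>Here \<open>F\<close> is the identity and \<open>T\<close> is empty.\<close>
        by (rule Runge) (use h z\<^sub>0W e3 in \<open>auto simp: hol_space_def\<close>)
      then show thesis using that by blast
    qed
    have "closed K1" "z\<^sub>0 \<notin> K1" using K1(2,4) z\<^sub>0W by (auto intro: compact_imp_closed)
    then obtain R where R: "\<And>z. z \<in> K1 \<Longrightarrow> norm (1 / (z - z\<^sub>0)) \<le> R"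
      using inverse_distance_bounded by blast
    obtain q where q: "q \<in> \<P>" "\<And>w. norm w \<le> R \<Longrightarrow> dist (poly p w) (poly q w) < e/3"
      using \<P>[OF e3] by blast
    obtain m where m: "1 / real (Suc m) < e/3"
      using e3 by (metis inverse_eq_divide reals_Archimedean)
    have "g \<in> hits K1 q (1 / real (Suc m))"
      by (rule hits[OF K1(1,2,4) q(1)])
    then obtain n where n: "n \<ge> 1" "\<And>z. z \<in> K1 \<Longrightarrow>
        dist (g ((f ^^ n) z)) (poly q (1 / (z - z\<^sub>0))) < 1 / real (Suc m)"
      by (auto simp: hits_def)
    have "dist (restrict (g \<circ> (f ^^ n)) W z) (h z) < e" if z: "z \<in> K" for z
    proof -
      let ?w = "1 / (z - z\<^sub>0)"
      have z1: "z \<in> K1" "z \<in> W" using z K1 by blast+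
      have "dist (g ((f ^^ n) z)) (poly q ?w) < e/3" using n(2)[OF z1(1)] m by linarith
      moreover have "dist (poly p ?w) (poly q ?w) < e/3" using q(2) R[OF z1(1)] by blast
      moreover have "dist (poly p ?w) (h z) < e/3" using p[OF z1(1)] .
      ultimately have "dist (g ((f ^^ n) z)) (h z) < e"
        using dist_triangle[of "g ((f ^^ n) z)" "h z" "poly q ?w"]
          dist_triangle3[of "poly q ?w" "h z" "poly p ?w"] by linarith
      then show ?thesis using z1(2) by simp
    qed
    moreover have "restrict (g \<circ> (f ^^ n)) W \<in> ?S" using n(1) by blast
    ultimately show "\<exists>k\<in>?S. \<forall>z\<in>K. dist (k z) (h z) < e"
      by (intro bexI[of _ "restrict (g \<circ> (f ^^ n)) W"] ballI)
  qed
  then show ?thesis using g by (simp only: universal_for_def simp_thms)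
qed

theorem comeager_universal:
  "comeager_in (hol_topology (UNIV - {z\<^sub>0}))
     {g \<in> hol_space (UNIV - {z\<^sub>0}). \<forall>W \<in> open_without_holes (U - {z\<^sub>0}). universal_for z\<^sub>0 f W g}"
proof -
  let ?H = "hol_space (UNIV - {z\<^sub>0})" and ?O = "open_without_holes (U - {z\<^sub>0})"
  obtain \<P> :: "complex poly set" where \<P>: "countable \<P>"
    "\<And>p R e. e > 0 \<Longrightarrow> \<exists>q\<in>\<P>. \<forall>w. norm w \<le> R \<longrightarrow> dist (poly p w) (poly q w) < e"
    by (rule countable_dense_polynomials) (rule that)
  obtain \<K> :: "complex set set" where \<K>: "countable \<K>"
    "\<And>K W. \<lbrakk>compact K; K \<subseteq> W; open W\<rbrakk> \<Longrightarrow> \<exists>K'\<in>\<K>. compact K' \<and> K \<subseteq> K' \<and> K' \<subseteq> W"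
    by (rule countable_compact_exhaustion) (rule that)
  define \<K>' where "\<K>' = {K \<in> \<K>. compact K \<and> (\<exists>W\<in>?O. K \<subseteq> W)}"
  \<comment> \<open>The whole space is inserted so that \<open>\<G>\<close> is non-empty, and so that its intersection lies in \<open>?H\<close>,
      even if \<open>\<K>'\<close> is empty.\<close>
  define \<G> where "\<G> = insert ?H ((\<lambda>(K, p, m). hits K p (1 / real (Suc m))) ` (\<K>' \<times> \<P> \<times> UNIV))"
  show ?thesis
  proof (rule comeager_in_countable_Inter[of _ \<G>])
    have "countable \<K>'" unfolding \<K>'_def using \<K>(1) by (rule countable_subset[rotated]) blast
    then show "countable \<G>" unfolding \<G>_def
      using \<P>(1) by (intro countable_insert countable_image countable_SIGMA) auto
    show "\<G> \<noteq> {}" by (simp add: \<G>_def)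
    show "open (UNIV - {z\<^sub>0})" by (intro open_Diff) auto
  next
    fix G assume "G \<in> \<G>"
    then consider "G = ?H" | K p m where "K \<in> \<K>'" "G = hits K p (1 / real (Suc m))"
      unfolding \<G>_def by auto
    then show "openin (hol_topology (UNIV - {z\<^sub>0})) G \<and> dense_in (hol_topology (UNIV - {z\<^sub>0})) G"
    proof cases
      case 1
      then show ?thesis
        using openin_topspace[of "hol_topology (UNIV - {z\<^sub>0})"] closure_of_topspace[of "hol_topology (UNIV - {z\<^sub>0})"]
        by (simp add: dense_in_def)
    next
      case 2
      then obtain W where W: "compact K" "W \<in> ?O" "K \<subseteq> W" by (auto simp: \<K>'_def)
      moreover have "K \<subseteq> U - {z\<^sub>0}" using W by (auto simp: open_without_holes_def)
      ultimately show ?thesis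
        unfolding 2(2) by (intro conjI openin_hits dense_in_hits[of W]) auto
    qed
  next
    show "\<Inter>\<G> \<subseteq> {g \<in> ?H. \<forall>W\<in>?O. universal_for z\<^sub>0 f W g}"
    proof
      fix g assume g: "g \<in> \<Inter>\<G>"
      then have gH: "g \<in> ?H" by (simp add: \<G>_def)
      have "universal_for z\<^sub>0 f W g" if W: "W \<in> ?O" for W
      proof (rule universal_if_hits[OF W gH])
        show "\<exists>K'\<in>\<K>. compact K' \<and> K \<subseteq> K' \<and> K' \<subseteq> W" if "compact K" "K \<subseteq> W" for K
          using \<K>(2) that W by (simp add: open_without_holes_def)
        show "\<exists>q\<in>\<P>. \<forall>w. norm w \<le> R \<longrightarrow> dist (poly p w) (poly q w) < e" if "e > 0" for p R e
          using that by (rule \<P>(2))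
        show "g \<in> hits K p (1 / real (Suc m))" if "K \<in> \<K>" "compact K" "K \<subseteq> W" "p \<in> \<P>" for K p m
        proof -
          have "K \<in> \<K>'" using that W unfolding \<K>'_def by blast
          then have "hits K p (1 / real (Suc m)) \<in> \<G>"
            unfolding \<G>_def using that(4) by (intro insertI2 image_eqI[of _ _ "(K, p, m)"]) auto
          then show ?thesis using g by blast
        qed
      qed
      then show "g \<in> {g \<in> ?H. \<forall>W\<in>?O. universal_for z\<^sub>0 f W g}" using gH by blast
    qed
  qed blast
qed

end

theorem theorem3p1:
  fixes z\<^sub>0 lam :: complex and f \<phi> :: "complex \<Rightarrow> complex" and D U V :: "complex set"
  assumes "open D" and "z\<^sub>0 \<in> D" and "f holomorphic_on D" and "f z\<^sub>0 = z\<^sub>0"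
    and "lam = deriv f z\<^sub>0" and "0 < cmod lam" and "cmod lam < 1"
    and "open U" and "z\<^sub>0 \<in> U" and "U \<subseteq> D" and "f ` U \<subseteq> U"
    and "open V" and "0 \<in> V" and "(\<lambda>v. lam * v) ` V \<subseteq> V"
    and "conformal_map \<phi> U V"
    and "\<And>(n::nat) z. n \<ge> 1 \<Longrightarrow> z \<in> U \<Longrightarrow> \<phi> ((f ^^ n) z) = lam ^ n * \<phi> z"
  shows "comeager_in (hol_topology (UNIV - {z\<^sub>0}))
           {g \<in> hol_space (UNIV - {z\<^sub>0}).
              \<forall>W \<in> open_without_holes (U - {z\<^sub>0}). universal_for z\<^sub>0 f W g}"
proof -
  interpret Koenigs_linearization z\<^sub>0 lam f \<phi> U
  proof
    show "f holomorphic_on U" using assms(3,10) by (rule holomorphic_on_subset)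
    show "\<phi> holomorphic_on U" "inj_on \<phi> U"
      using assms(15) by (auto simp: conformal_map_def bij_betw_def)
    show "\<phi> (f z) = lam * \<phi> z" if "z \<in> U" for z
      using assms(16)[of 1 z] that by simp
  qed (use assms in auto)
  show ?thesis by (rule comeager_universal)
qed

end
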